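(* Let $D$ be a regular dodecahedron with edges of length $1$, and for $t>0$ let $N(t)$ be the number of waves that arrive up to time $t$ at the vertices of $D$, in the sense explained in the context. Then there exists a constant $c>0$ such that $N(t) < \exp\left(c\,t^{5/6}\right)$.
   Context: Wave model: the surface of $D$ is a flat surface with conical singularities at the vertices. At time $0$ a concentric wave emanates from a chosen vertex $S$ and propagates along the surface with unit speed; whenever a wave reaches a vertex, a new concentric wave is emitted from that vertex. Waves thus travel along broken geodesic paths on the surface of $D$ that start at $S$, end at a vertex, and consist of consecutive geodesic segments (straight segments in the flat metric of the surface) each joining two vertices; the arrival time of a wave is the total length of such a path. $N(t)$ is the number of distinct values not exceeding $t$ taken by the lengths of such broken geodesic paths (waves arriving at the same time are counted once). *)

theory Defs
  imports "HOL-Analysis.Analysis"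
begin

definition regular_polygon :: "nat \<Rightarrow> real \<Rightarrow> 'a::euclidean_space set \<Rightarrow> bool" where
  "regular_polygon n a F \<longleftrightarrow>
     (\<exists>c u v r p. norm u = 1 \<and> norm v = 1 \<and> u \<bullet> v = 0 \<and> r > 0 \<and>
        (\<forall>k::nat. p k = c + (r * cos (2 * pi * real k / real n)) *\<^sub>R u
                        + (r * sin (2 * pi * real k / real n)) *\<^sub>R v) \<and>
        F = convex hull (p ` {..<n}) \<and> dist (p 0) (p 1) = a)"

definition vertices :: "'a::euclidean_space set \<Rightarrow> 'a set" where
  "vertices D = {v. v extreme_point_of D}"

(* The Platonic solid {5,3}, in arbitrary position in space; a is the edge length. *)
definition regular_dodecahedron :: "real \<Rightarrow> (real^3) set \<Rightarrow> bool" where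
  "regular_dodecahedron a D \<longleftrightarrow>
     polytope D \<and> interior D \<noteq> {} \<and>
     card {F. F facet_of D} = 12 \<and>
     (\<forall>F. F facet_of D \<longrightarrow> regular_polygon 5 a F) \<and>
     (\<forall>v\<in>vertices D. card {F. F facet_of D \<and> v \<in> F} = 3)"

(* A chart of the flat metric on the surface of D, with the Euclidean plane taken to be the
   type complex.  Isometry on each facet together with injectivity means that, across an
   edge, the chart unfolds the two adjacent facets into the plane.  No chart contains a
   vertex of a dodecahedron: there the total angle is less than 2 * pi. *)
definition flat_chart :: "(real^3) set \<Rightarrow> (real^3) set \<Rightarrow> (real^3 \<Rightarrow> complex) \<Rightarrow> bool" where
  "flat_chart D W h \<longleftrightarrow>
     openin (top_of_set (frontier D)) W \<and> open (h ` W) \<and> inj_on h W \<and>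
     (\<forall>F. F facet_of D \<longrightarrow> (\<forall>x\<in>W \<inter> F. \<forall>y\<in>W \<inter> F. dist (h x) (h y) = dist x y))"

(* g, parametrised by arc length on [0, L], joins the vertices a and b (possibly a = b), meets
   no vertex in between, and is a straight line at unit speed when read in flat charts. *)
definition geodesic_segment ::
  "(real^3) set \<Rightarrow> (real \<Rightarrow> real^3) \<Rightarrow> real \<Rightarrow> real^3 \<Rightarrow> real^3 \<Rightarrow> bool" where
  "geodesic_segment D g L a b \<longleftrightarrow>
     L > 0 \<and> continuous_on {0..L} g \<and> g ` {0..L} \<subseteq> frontier D \<and>
     a \<in> vertices D \<and> b \<in> vertices D \<and> g 0 = a \<and> g L = b \<and>
     (\<forall>s\<in>{0<..<L}. g s \<notin> vertices D \<and>
        (\<exists>W h \<epsilon> z w. flat_chart D W h \<and> \<epsilon> > 0 \<and> norm w = 1 \<and>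
           {s-\<epsilon><..<s+\<epsilon>} \<subseteq> {0<..<L} \<and>
           (\<forall>x\<in>{s-\<epsilon><..<s+\<epsilon>}. g x \<in> W \<and> h (g x) = z + x *\<^sub>R w)))"

(* broken_geodesic D a b l: l is the total length of some broken geodesic path from a to b. *)
inductive broken_geodesic :: "(real^3) set \<Rightarrow> real^3 \<Rightarrow> real^3 \<Rightarrow> real \<Rightarrow> bool"
  for D :: "(real^3) set" and a :: "real^3" where
  single: "geodesic_segment D g L a b \<Longrightarrow> broken_geodesic D a b L"
| append: "broken_geodesic D a b l \<Longrightarrow> geodesic_segment D g L b c
    \<Longrightarrow> broken_geodesic D a c (l + L)"

definition arrival_times :: "(real^3) set \<Rightarrow> real^3 \<Rightarrow> real \<Rightarrow> real set" where
  "arrival_times D S t = {l. l \<le> t \<and> (\<exists>b. broken_geodesic D S b l)}"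

definition num_waves :: "(real^3) set \<Rightarrow> real^3 \<Rightarrow> real \<Rightarrow> nat" where
  "num_waves D S t = card (arrival_times D S t)"

end

theory Submission
  imports Defs
begin

text \<open>Unfold the facets met by a geodesic segment into the complex plane, so that the segment becomes an
  interval of the real axis. Successive pentagons are half turns of each other about the midpoint of
  the crossed edge, so all their vertices lie in a translate of a rotated and scaled copy of
  \<open>\<int>[\<zeta>]\<close>, \<open>\<zeta> = exp (2\<pi>\<i>/5)\<close>, and each crossing changes the coordinates by a bounded amount. Two
  consecutive chords cannot both be short, because a straight line cannot cut off the same corner
  twice; so a segment of length \<open>L\<close> has \<open>O(L)\<close> crossings, and its length is a fixed multiple of
  \<open>\<bar>\<Sum>i<5. m\<^sub>i \<zeta>\<^sup>i\<bar>\<close> with integers \<open>m\<^sub>i = O(L)\<close>. There are thus \<open>O(t\<^sup>5)\<close> lengths up to \<open>t\<close>.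

  The arrival times are finite sums of such lengths. As for partitions, the number of sums up to \<open>t\<close>
  is at most \<open>exp (x t)\<close> times the product of \<open>1 / (1 - exp (- x \<lambda>))\<close> over the lengths \<open>\<lambda>\<close>, which is
  \<open>exp (x t + O(x powr -5))\<close>; take \<open>x = t powr (-1/6)\<close>.\<close>

text \<open>The ring \<int>[\<zeta>] has rank 4 and is dense in the plane, so a bound on the length
  alone would leave infinitely many candidate lattice points. Finiteness comes from bounding the
  coefficients, hence from bounding the number of crossings in terms of the length.

  The definition of a segment supplies charts only, and only at inner times. The sequence of facets
  therefore has to be built, and nothing local tells that the segment stays in one facet near its
  end vertices. This is settled globally: a segment followed from its midpoint makes boundedly many
  crossings, so some facet contains a final piece; the reversed segment then gives a facet
  containing an initial piece, and only with that can the unfolding begin at the starting vertex.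

  The exponent is 5/6 because a count of order \<open>s ^ 5\<close> makes the logarithm of the
  partition function of order \<open>B ^ 5\<close>, where \<open>B = 1 / x\<close>; the terms
  \<open>t / B\<close> and \<open>B ^ 5\<close> balance at \<open>B = t powr (1/6)\<close>.\<close>

section \<open>Regular pentagons in the complex plane\<close>

definition zeta5 :: complex where "zeta5 = cis (2 * pi / 5)"

lemma zeta5_pow5: "zeta5 ^ 5 = 1"
proof -
  have "zeta5 ^ 5 = cis (real 5 * (2 * pi / 5))" unfolding zeta5_def by (rule Complex.DeMoivre)
  also have "real 5 * (2 * pi / 5) = 2 * pi" by simp
  finally show ?thesis by (simp only: cis_2pi)
qed

lemma norm_zeta5 [simp]: "norm zeta5 = 1"
  by (simp add: zeta5_def)

text \<open>These crude bounds locate the vertices relative to an edge. In particular,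
  \<open>Im zeta5\<close> is the height above a unit edge of the two vertices next to it, so a
  rectangle of height 1/2 over the edge stays below them.\<close>

lemma zeta5_bounds: "0 < Re zeta5" "Re zeta5 < 1/2" "1/2 < Im zeta5"
proof -
  show "0 < Re zeta5" unfolding zeta5_def by (simp add: cos_gt_zero)
  have "cos (2 * pi / 5) < cos (pi / 3)" by (rule cos_monotone_0_pi) auto
  then show "Re zeta5 < 1/2" by (simp add: zeta5_def cos_60)
  have "sin (pi / 6) < sin (2 * pi / 5)" by (rule sin_monotone_2pi) auto
  then show "1/2 < Im zeta5" by (simp add: zeta5_def sin_30)
qed

lemma zeta5_neq_1: "zeta5 \<noteq> 1"
  using zeta5_bounds by force

lemma zeta5_nonzero [simp]: "zeta5 \<noteq> 0"
  using zeta5_bounds by force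

lemma zeta5_sum: "1 + zeta5 + zeta5^2 + zeta5^3 + zeta5^4 = 0"
proof -
  have "(zeta5 - 1) * (1 + zeta5 + zeta5^2 + zeta5^3 + zeta5^4) = zeta5 ^ 5 - 1"
    by (simp add: eval_nat_numeral algebra_simps)
  then show ?thesis using zeta5_pow5 zeta5_neq_1 by simp
qed

lemma zeta5_pow4: "zeta5 ^ 4 = cnj zeta5"
proof -
  have "zeta5 ^ 4 * zeta5 = cnj zeta5 * zeta5"
    using zeta5_pow5 complex_norm_square[of zeta5] by (simp add: eval_nat_numeral mult_ac)
  then show ?thesis by simp
qed

lemma zeta5_square: "zeta5^2 = 2 * Re zeta5 * zeta5 - 1"
proof -
  have "zeta5 * (zeta5 + cnj zeta5) = zeta5^2 + 1"
    using complex_norm_square[of zeta5] by (simp add: algebra_simps power2_eq_square)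
  then show ?thesis by (simp add: complex_add_cnj algebra_simps)
qed

lemma zeta5_pow_add_5: "zeta5 ^ (5 * m + n) = zeta5 ^ n"
  by (simp only: power_add power_mult zeta5_pow5 power_one mult_1)

lemma zeta5_pow_mod: "zeta5 ^ n = zeta5 ^ (n mod 5)"
  using zeta5_pow_add_5[of "n div 5" "n mod 5"] by simp

text \<open>\<open>q\<close> is the center and \<open>u\<close> the vector from it to one vertex.
  The edges have length \<open>norm (u * (zeta5 - 1))\<close>, which explains the recurring
  condition that this norm is 1.\<close>

definition pentagon :: "complex \<Rightarrow> complex \<Rightarrow> complex set" where
  "pentagon q u = convex hull ((\<lambda>k. q + u * zeta5 ^ k) ` {..<5})"

lemma lessThan_5: "{..<5::nat} = {0, 1, 2, 3, 4}" by auto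

lemma pentagon_vertex_set: "(\<lambda>k. q + u * zeta5 ^ k) ` {..<5} = range (\<lambda>k. q + u * zeta5 ^ k)"
proof -
  have "q + u * zeta5 ^ k \<in> (\<lambda>k. q + u * zeta5 ^ k) ` {..<5}" for k
    by (rule image_eqI[of _ _ "k mod 5"]) (simp_all flip: zeta5_pow_mod)
  then show ?thesis by auto
qed

lemma pentagon_rotate: "pentagon q (u * zeta5 ^ i) = pentagon q u"
proof -
  have "range (\<lambda>k. q + u * zeta5 ^ i * zeta5 ^ k) = range (\<lambda>k. q + u * zeta5 ^ k)"
  proof safe
    fix k
    show "q + u * zeta5 ^ i * zeta5 ^ k \<in> range (\<lambda>k. q + u * zeta5 ^ k)"
      by (rule range_eqI[of _ _ "i + k"]) (simp add: power_add)
    \<comment> \<open>Exponents are natural numbers; modulo 5, adding \<open>4 * i\<close> undoes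
      adding \<open>i\<close>.\<close>
    have "i + (4 * i + k) = 5 * i + k" by simp
    then have "zeta5 ^ i * zeta5 ^ (4 * i + k) = zeta5 ^ k"
      by (simp only: power_add[symmetric] zeta5_pow_add_5)
    then show "q + u * zeta5 ^ k \<in> range (\<lambda>k. q + u * zeta5 ^ i * zeta5 ^ k)"
      by (intro range_eqI[of _ _ "4 * i + k"]) (simp add: mult.assoc)
  qed
  then show ?thesis by (simp add: pentagon_def pentagon_vertex_set)
qed

text \<open>The parameter \<open>w\<close> allows for orientation-reversing maps, which turn powers
  of \<open>zeta5\<close> into powers of \<open>cnj zeta5\<close>.\<close>

lemma pentagon_linear_image:
  assumes "linear l" "\<And>k. l (u * zeta5 ^ k) = v * w ^ k" "range (\<lambda>k. v * w ^ k) = range (\<lambda>k. v * zeta5 ^ k)"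
  shows "(\<lambda>z. p + l z) ` pentagon q u = pentagon (p + l q) v"
proof -
  have "(\<lambda>z. p + l z) ` pentagon q u = (+) p ` l ` (convex hull (range (\<lambda>k. q + u * zeta5 ^ k)))"
    by (simp add: pentagon_def pentagon_vertex_set image_image)
  also have "\<dots> = convex hull ((+) p ` l ` range (\<lambda>k. q + u * zeta5 ^ k))"
    by (simp add: convex_hull_linear_image[OF assms(1)] convex_hull_translation)
  also have "(+) p ` l ` range (\<lambda>k. q + u * zeta5 ^ k) = (+) (p + l q) ` range (\<lambda>k. v * w ^ k)"
    by (simp add: image_image linear_add[OF assms(1)] assms(2) add.assoc)
  also have "\<dots> = range (\<lambda>k. (p + l q) + v * zeta5 ^ k)"
    by (simp add: assms(3) image_image)
  finally show ?thesis by (simp add: pentagon_def pentagon_vertex_set)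
qed

lemma pentagon_image:
  "(\<lambda>z. p + U * z) ` pentagon q u = pentagon (p + U * q) (U * u)"
  by (rule pentagon_linear_image[where w = zeta5])
     (auto intro!: linearI simp: algebra_simps)

lemma range_cnj_zeta5: "range (\<lambda>k. v * cnj zeta5 ^ k) = range (\<lambda>k. v * zeta5 ^ k)"
proof safe
  fix k
  show "v * cnj zeta5 ^ k \<in> range (\<lambda>k. v * zeta5 ^ k)"
    by (rule range_eqI[of _ _ "4 * k"]) (simp add: power_mult zeta5_pow4)
  have "zeta5 = cnj (zeta5 ^ 4)" by (simp add: zeta5_pow4)
  then show "v * zeta5 ^ k \<in> range (\<lambda>k. v * cnj zeta5 ^ k)"
    by (intro range_eqI[of _ _ "4 * k"]) (simp add: power_mult)
qed

lemma pentagon_image_cnj: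
  "(\<lambda>z. p + U * cnj z) ` pentagon q u = pentagon (p + U * cnj q) (U * cnj u)"
  by (rule pentagon_linear_image[OF _ _ range_cnj_zeta5])
     (auto intro!: linearI simp: algebra_simps)

lemma convex_pentagon: "convex (pentagon q u)"
  by (simp add: pentagon_def)

lemma vertex_in_pentagon: "q + u * zeta5 ^ k \<in> pentagon q u"
  unfolding pentagon_def pentagon_vertex_set by (intro hull_inc rangeI)

lemma center_in_pentagon: "q \<in> pentagon q u"
proof -
  have *: "(\<Sum>k\<in>{..<5::nat}. (1/5) *\<^sub>R (q + u * zeta5 ^ k)) \<in> pentagon q u"
    by (rule convex_sum) (auto simp: convex_pentagon vertex_in_pentagon)
  have "(\<Sum>k\<in>{..<5::nat}. (1/5) *\<^sub>R (q + u * zeta5 ^ k))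
      = (1/5) *\<^sub>R (5 * q + u * (1 + zeta5 + zeta5^2 + zeta5^3 + zeta5^4))"
    by (simp add: lessThan_5 algebra_simps scaleR_conv_of_real)
  then show ?thesis using * by (simp add: zeta5_sum scaleR_conv_of_real)
qed

lemma extreme_point_of_pentagon:
  assumes "x extreme_point_of pentagon q u"
  obtains k where "x = q + u * zeta5 ^ k"
  using assms extreme_point_of_convex_hull[of x] unfolding pentagon_def by blast

text \<open>A diagonal is not a face because its midpoint lies between the center and the vertex
  it cuts off.\<close>
lemma pentagon_diagonal_not_face:
  assumes "u \<noteq> 0"
  shows "\<not> closed_segment (q + u) (q + u * zeta5^2) face_of pentagon q u"
proof
  assume face: "closed_segment (q + u) (q + u * zeta5^2) face_of pentagon q u"
  define m where "m = q + (Re zeta5) *\<^sub>R (u * zeta5)"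
  have "m = (1/2) *\<^sub>R (q + u) + (1/2) *\<^sub>R (q + u * zeta5^2)"
    unfolding m_def zeta5_square by (simp add: scaleR_conv_of_real field_simps)
  then have "m \<in> closed_segment (q + u) (q + u * zeta5^2)"
    unfolding in_segment by (intro exI[of _ "1/2"]) simp
  moreover have "m \<in> open_segment q (q + u * zeta5)"
    unfolding in_segment m_def using zeta5_bounds assms
    by (intro conjI exI[of _ "Re zeta5"]) (auto simp: algebra_simps)
  ultimately have "q \<in> closed_segment (q + u) (q + u * zeta5^2)"
    using face_ofD[OF face, of m q "q + u * zeta5"] center_in_pentagon[of q u]
      vertex_in_pentagon[of q u 1] by (simp only: power_one_right)
  then obtain t where t: "q = (1 - t) *\<^sub>R (q + u) + t *\<^sub>R (q + u * zeta5^2)"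
    by (auto simp: in_segment)
  then have "u * (1 - t + t * zeta5^2) = 0"
    by (simp add: scaleR_conv_of_real algebra_simps)
  then have eq: "1 - t + t * zeta5^2 = 0" using assms by simp
  have "Im (1 - t + t * zeta5^2) = t * (2 * Re zeta5 * Im zeta5)"
    by (simp add: zeta5_square)
  then have "t * (2 * Re zeta5 * Im zeta5) = 0" by (simp only: eq zero_complex.simps)
  then have "t = 0" using zeta5_bounds by auto
  then show False using eq by simp
qed

text \<open>The ends of a face that is a segment are extreme points, hence vertices of the pentagon.
  Their indices differ by 1 or 4 (an edge, in one of its two directions) or by 2 or 3 (a diagonal,
  which is not a face).\<close>

lemma pentagon_edge:
  assumes face: "closed_segment a b face_of pentagon q u" and "a \<noteq> b" "u \<noteq> 0"
  obtains i u' where "u' = u * zeta5 ^ i" "a = q + u' \<and> b = q + u' * zeta5 \<or> b = q + u' \<and> a = q + u' * zeta5"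
proof -
  have "a extreme_point_of pentagon q u" "b extreme_point_of pentagon q u"
    using extreme_point_of_face[OF face, of a] extreme_point_of_face[OF face, of b]
    by (simp_all add: extreme_point_of_segment)
  then obtain i j where a: "a = q + u * zeta5 ^ i" and b: "b = q + u * zeta5 ^ j"
    by (meson extreme_point_of_pentagon)
  \<comment> \<open>The index difference \<open>j - i\<close> modulo 5, written without
    subtraction.\<close>
  define d where "d = (4 * i + j) mod 5"
  have "i + (4 * i + j) = 5 * i + j" by simp
  then have "zeta5 ^ i * zeta5 ^ (4 * i + j) = zeta5 ^ j"
    by (simp only: power_add[symmetric] zeta5_pow_add_5)
  then have b': "b = q + u * zeta5 ^ i * zeta5 ^ d"
    unfolding d_def zeta5_pow_mod[of "4 * i + j", symmetric]
    by (simp add: b mult.assoc)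
  have "d < 5" by (simp add: d_def)
  moreover have "d \<noteq> 0" using a b' \<open>a \<noteq> b\<close> by (intro notI) simp
  ultimately consider "d = 1" | "d = 2" | "d = 3" | "d = 4" by linarith
  then show ?thesis
  proof cases
    case 1
    then show ?thesis using that[of "u * zeta5 ^ i" i] a b' by simp
  next
    case 2
    then show ?thesis
      using pentagon_diagonal_not_face[of "u * zeta5 ^ i" q] face assms(3) a b'
      by (simp add: pentagon_rotate)
  next
    case 3
    have "a = q + u * zeta5 ^ (i + 3) * zeta5 ^ 2"
    proof -
      have "zeta5 ^ (i + 3) * zeta5 ^ 2 = zeta5 ^ i * zeta5 ^ 5"
        by (simp add: add.commute flip: power_add)
      then show ?thesis using a by (simp add: mult.assoc zeta5_pow5)
    qed
    moreover have "b = q + u * zeta5 ^ (i + 3)" using b' 3 by (simp add: power_add mult.assoc)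
    ultimately show ?thesis
      using pentagon_diagonal_not_face[of "u * zeta5 ^ (i + 3)" q] face assms(3)
      by (simp add: pentagon_rotate closed_segment_commute)
  next
    case 4
    have "a = q + u * zeta5 ^ (i + 4) * zeta5"
    proof -
      have "zeta5 ^ (i + 4) * zeta5 = zeta5 ^ i * zeta5 ^ 5"
        by (simp add: eval_nat_numeral)
      then show ?thesis using a by (simp add: mult.assoc zeta5_pow5)
    qed
    moreover have "b = q + u * zeta5 ^ (i + 4)" using b' 4 by (simp add: power_add mult.assoc)
    ultimately show ?thesis using that[of "u * zeta5 ^ (i + 4)" "i + 4"] by simp
  qed
qed

text \<open>Each pentagon runs through the edge in one of two directions. Equal directions force
  equal centers; opposite directions make the second pentagon the half turn of the first about the
  midpoint of the edge, which takes the center \<open>q\<close> to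
  \<open>(a + b) - q\<close>.\<close>

lemma pentagons_sharing_edge:
  assumes "closed_segment a b face_of pentagon q u" "closed_segment a b face_of pentagon q2 u2"
    and "a \<noteq> b" "u \<noteq> 0" "u2 \<noteq> 0"
  shows "pentagon q2 u2 = pentagon q u \<or>
    (\<exists>i u'. u' = u * zeta5 ^ i \<and> closed_segment a b = closed_segment (q + u') (q + u' * zeta5) \<and>
       open_segment a b = open_segment (q + u') (q + u' * zeta5) \<and>
       pentagon q2 u2 = pentagon (q + u' * (1 + zeta5)) (- u'))"
proof -
  obtain i u' where u': "u' = u * zeta5 ^ i"
    "a = q + u' \<and> b = q + u' * zeta5 \<or> b = q + u' \<and> a = q + u' * zeta5"
    using pentagon_edge assms by metis
  obtain j v where v: "v = u2 * zeta5 ^ j"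
    "a = q2 + v \<and> b = q2 + v * zeta5 \<or> b = q2 + v \<and> a = q2 + v * zeta5"
    using pentagon_edge assms by metis
  have P: "pentagon q u = pentagon q u'" "pentagon q2 u2 = pentagon q2 v"
    by (simp_all add: u' v pentagon_rotate)
  have same: "v = u' \<and> q2 = q" if "q2 + v = q + u'" "q2 + v * zeta5 = q + u' * zeta5"
  proof -
    have "v * (zeta5 - 1) = u' * (zeta5 - 1)" using that by (simp add: algebra_simps) (metis add_diff_cancel_left diff_diff_eq2 diff_eq_eq)
    then show ?thesis using zeta5_neq_1 that by simp
  qed
  have opp: "v = - u' \<and> q2 = q + u' * (1 + zeta5)" if "q2 + v = q + u' * zeta5" "q2 + v * zeta5 = q + u'"
  proof -
    have "v * (zeta5 - 1) = (q2 + v * zeta5) - (q2 + v)" by (simp add: algebra_simps)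
    also have "\<dots> = (- u') * (zeta5 - 1)" using that by (simp add: algebra_simps)
    finally have "v = - u'" using zeta5_neq_1 by (metis mult_right_cancel right_minus_eq)
    then show ?thesis using that by (simp add: algebra_simps)
  qed
  show ?thesis
    using u'(2) v(2) same opp P u'(1) closed_segment_commute open_segment_commute by metis
qed

section \<open>The pentagon near one of its edges\<close>

lemma convex_halfplane_Re_Im: "convex {z. c \<le> a * Re z + b * Im z}"
proof -
  have "convex {z. Complex a b \<bullet> z \<ge> c}" by (rule convex_halfspace_ge)
  then show ?thesis by (simp add: inner_complex_def)
qed

text \<open>In the coordinate of \<open>w\<close> the edge is the unit interval and the pentagon
  lies above it. The three half planes form a crude outer bound that meets the real axis exactly in
  the edge; the rectangle is an inner bound.\<close>

lemma pentagon_edge_coordinates: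
  fixes q u :: complex
  defines "w \<equiv> \<lambda>x. q + u + u * (zeta5 - 1) * x"
  shows "u \<noteq> 0 \<Longrightarrow> w x \<in> pentagon q u \<Longrightarrow> 0 \<le> Im x \<and> 0 \<le> Re x + Im x \<and> Re x - Im x \<le> 1"
    and "0 \<le> Re x \<Longrightarrow> Re x \<le> 1 \<Longrightarrow> 0 \<le> Im x \<Longrightarrow> Im x \<le> 1/2 \<Longrightarrow> w x \<in> pentagon q u"
proof -
  define V where "V = {0, 1, 1 + zeta5, 1 + zeta5 + zeta5^2, - cnj zeta5}"
  have e: "w 0 = q + u" "w 1 = q + u * zeta5" "w (1 + zeta5) = q + u * zeta5^2"
    "w (1 + zeta5 + zeta5^2) = q + u * zeta5^3" "w (- cnj zeta5) = q + u * zeta5^4"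
  proof -
    have "- cnj zeta5 = 1 + zeta5 + zeta5^2 + zeta5^3"
      using zeta5_sum zeta5_pow4 by (simp add: add_eq_0_iff)
    then have "w (- cnj zeta5) = q + u + u * ((zeta5 - 1) * (1 + zeta5 + zeta5^2 + zeta5^3))"
      by (simp only: w_def mult.assoc)
    also have "(zeta5 - 1) * (1 + zeta5 + zeta5^2 + zeta5^3) = zeta5^4 - 1"
      by (simp add: eval_nat_numeral algebra_simps)
    finally show "w (- cnj zeta5) = q + u * zeta5^4" by (simp add: algebra_simps)
  qed (simp_all add: w_def eval_nat_numeral algebra_simps)
  have P: "pentagon q u = w ` (convex hull V)"
  proof -
    have lin: "linear ((*) (u * (zeta5 - 1)))" by (auto intro!: linearI simp: algebra_simps)
    have "w ` (convex hull V) = (+) (q + u) ` (*) (u * (zeta5 - 1)) ` (convex hull V)"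
      by (simp add: w_def image_image)
    also have "\<dots> = convex hull ((+) (q + u) ` (*) (u * (zeta5 - 1)) ` V)"
      by (simp only: convex_hull_linear_image[OF lin] convex_hull_translation)
    also have "(+) (q + u) ` (*) (u * (zeta5 - 1)) ` V = w ` V"
      by (simp add: w_def image_image)
    also have "w ` V = (\<lambda>k. q + u * zeta5 ^ k) ` {..<5}"
      by (simp add: V_def e lessThan_5)
    finally show ?thesis by (simp add: pentagon_def)
  qed
  note b = zeta5_bounds
  define p where "p = Re zeta5 * Im zeta5"
  have R2: "Re (zeta5^2) = 2 * (Re zeta5)^2 - 1" and I2: "Im (zeta5^2) = 2 * p"
    unfolding zeta5_square p_def by (simp_all add: power2_eq_square)
  have c2: "0 < (Re zeta5)^2" "(Re zeta5)^2 < 1/4" "0 < p"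
    using b power_strict_mono[of "Re zeta5" "1/2" 2] by (simp_all add: power_divide p_def)
  {
    assume "u \<noteq> 0" "w x \<in> pentagon q u"
    then have x: "x \<in> convex hull V"
      using zeta5_neq_1 by (auto simp: P w_def)
    have "V \<subseteq> {z. 0 \<le> 0 * Re z + 1 * Im z}" "V \<subseteq> {z. 0 \<le> 1 * Re z + 1 * Im z}"
      "V \<subseteq> {z. -1 \<le> (-1) * Re z + 1 * Im z}"
      using b R2 I2 c2 by (auto simp: V_def)
    then have "convex hull V \<subseteq> {z. 0 \<le> 0 * Re z + 1 * Im z}"
      "convex hull V \<subseteq> {z. 0 \<le> 1 * Re z + 1 * Im z}"
      "convex hull V \<subseteq> {z. -1 \<le> (-1) * Re z + 1 * Im z}"
      by (simp_all only: hull_minimal convex_halfplane_Re_Im)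
    then show "0 \<le> Im x \<and> 0 \<le> Re x + Im x \<and> Re x - Im x \<le> 1"
      using x by force
  }
  {
    assume x: "0 \<le> Re x" "Re x \<le> 1" "0 \<le> Im x" "Im x \<le> 1/2"
    define s where "s = Im zeta5"
    have s: "s > 1/2" using b by (simp add: s_def)
    \<comment> \<open>\<open>t\<close> locates the point above \<open>Re x\<close> on the diagonal
      from \<open>- cnj zeta5\<close> to \<open>1 + zeta5\<close>, which is parallel to the edge, at
      height \<open>Im zeta5\<close>, and of length \<open>1 + 2 * Re zeta5\<close>.\<close>
    define t where "t = (Re x + Re zeta5) / (1 + 2 * Re zeta5)"
    have t: "0 \<le> t" "t \<le> 1" using x b by (auto simp: t_def)
    have top: "Complex (Re x) s \<in> convex hull V"
    proof -
      have "Complex (Re x) s = (1 - t) *\<^sub>R (- cnj zeta5) + t *\<^sub>R (1 + zeta5)"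
        using b by (auto simp: complex_eq_iff s_def t_def divide_simps) (auto simp: algebra_simps)
      then show ?thesis
        using t by (simp only:, intro convexD) (auto simp: V_def hull_inc)
    qed
    have bot: "of_real (Re x) \<in> convex hull V"
    proof -
      have "of_real (Re x) = (1 - Re x) *\<^sub>R (0::complex) + Re x *\<^sub>R 1" by (simp add: scaleR_conv_of_real)
      then show ?thesis
        using x by (simp only:, intro convexD) (auto simp: V_def hull_inc)
    qed
    have "x = (1 - Im x / s) *\<^sub>R of_real (Re x) + (Im x / s) *\<^sub>R Complex (Re x) s"
      using s by (auto simp: complex_eq_iff algebra_simps)
    moreover have "(1 - Im x / s) *\<^sub>R of_real (Re x) + (Im x / s) *\<^sub>R Complex (Re x) s \<in> convex hull V"
      by (intro convexD top bot) (use x s in auto)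
    ultimately show "w x \<in> pentagon q u" by (simp add: P)
  }
qed

lemma pentagon_interior_strip:
  assumes u: "u \<noteq> 0" and x: "0 < Re x" "Re x < 1" "0 < Im x" "Im x < 1/2"
  shows "q + u + u * (zeta5 - 1) * x \<in> interior (pentagon q u)"
proof -
  define e where "e = u * (zeta5 - 1)"
  have e: "e \<noteq> 0" using u zeta5_neq_1 by (simp add: e_def)
  define f where "f = (\<lambda>z. (z - (q + u)) / e)"
  define T where "T = {z. 0 < Re (f z) \<and> Re (f z) < 1 \<and> 0 < Im (f z) \<and> Im (f z) < 1/2}"
  have "open T" unfolding T_def f_def
    by (intro open_Collect_conj open_Collect_less continuous_intros) (use e in auto)
  moreover have "T \<subseteq> pentagon q u"
  proof
    fix z assume "z \<in> T"
    then have "q + u + e * f z \<in> pentagon q u"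
      using pentagon_edge_coordinates(2)[of "f z" q u] by (simp add: T_def e_def)
    then show "z \<in> pentagon q u" using e by (simp add: f_def)
  qed
  moreover have "q + u + e * x \<in> T" using x e by (simp add: T_def f_def)
  ultimately show ?thesis unfolding e_def by (meson interiorI)
qed

text \<open>A straight line through an inner point of an edge crosses the rectangle of height \<open>1/2\<close>
  on either side of that edge, and this rectangle lies in the union of the two pentagons.\<close>
lemma two_pentagon_crossing:
  fixes s0 s1 s2 :: real
  assumes norm: "norm (u * (zeta5 - 1)) = 1" and less: "s0 < s1" "s1 < s2"
    and s1: "of_real s1 \<in> open_segment (q + u) (q + u * zeta5)"
    and s0: "of_real s0 \<in> pentagon q u" "of_real s0 \<notin> interior (pentagon q u)"
      "of_real s0 \<notin> closed_segment (q + u) (q + u * zeta5)"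
    and s2: "of_real s2 \<in> pentagon (q + u * (1 + zeta5)) (- u)"
      "of_real s2 \<notin> interior (pentagon (q + u * (1 + zeta5)) (- u))"
  shows "s2 - s0 \<ge> 1/2"
proof -
  define e where "e = u * (zeta5 - 1)"
  have u: "u \<noteq> 0" and e: "e \<noteq> 0" "norm e = 1" using norm by (auto simp: e_def)
  define f where "f = (\<lambda>s. (of_real s - (q + u)) / e)"
  define \<alpha> where "\<alpha> = 1 / e"
  have fe: "of_real s = q + u + e * f s" for s using e by (simp add: f_def)
  have fs: "f s = f s1 + of_real (s - s1) * \<alpha>" for s
    by (simp add: f_def \<alpha>_def diff_divide_distrib[symmetric] add_divide_distrib[symmetric] algebra_simps)
  have Ref: "Re (f s) = Re (f s1) + (s - s1) * Re \<alpha>" for s by (subst fs) simp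
  have Imf: "Im (f s) = Im (f s1) + (s - s1) * Im \<alpha>" for s by (subst fs) simp
  have "norm \<alpha> = 1" using e by (simp add: \<alpha>_def norm_divide)
  then have \<alpha>: "\<bar>Re \<alpha>\<bar> \<le> 1" "\<bar>Im \<alpha>\<bar> \<le> 1" using abs_Re_le_cmod[of \<alpha>] abs_Im_le_cmod[of \<alpha>] by auto
  obtain t where t: "0 < t" "t < 1" "of_real s1 = (1 - t) *\<^sub>R (q + u) + t *\<^sub>R (q + u * zeta5)"
    using s1 unfolding in_segment by auto
  have "f s1 = of_real t"
  proof -
    have "of_real s1 - (q + u) = of_real t * e"
      unfolding t(3) e_def by (simp add: scaleR_conv_of_real algebra_simps)
    then show ?thesis using e by (simp add: f_def)
  qed
  then have f1: "Re (f s1) = t" "Im (f s1) = 0" by simp_all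
  have c0: "0 \<le> Im (f s0) \<and> 0 \<le> Re (f s0) + Im (f s0) \<and> Re (f s0) - Im (f s0) \<le> 1"
    using pentagon_edge_coordinates(1)[OF u, of q "f s0"] s0(1) fe[of s0] by (simp add: e_def)
  have Im0: "Im (f s0) > 0"
  proof (rule ccontr)
    assume "\<not> ?thesis"
    then have "Im (f s0) = 0" "0 \<le> Re (f s0)" "Re (f s0) \<le> 1" using c0 by auto
    then have "f s0 = of_real (Re (f s0))" by (simp add: complex_eq_iff)
    then have "of_real s0 = q + u + e * of_real (Re (f s0))" using fe[of s0] by simp
    also have "\<dots> = (1 - Re (f s0)) *\<^sub>R (q + u) + Re (f s0) *\<^sub>R (q + u * zeta5)"
      by (simp add: e_def scaleR_conv_of_real algebra_simps)
    finally show False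
      using s0(3) \<open>0 \<le> Re (f s0)\<close> \<open>Re (f s0) \<le> 1\<close> unfolding in_segment by blast
  qed
  have n0: "\<not> (0 < Re (f s0) \<and> Re (f s0) < 1 \<and> Im (f s0) < 1/2)"
    using pentagon_interior_strip[OF u, of "f s0" q] s0(2) fe[of s0] Im0 by (auto simp: e_def)
  have Im\<alpha>: "Im \<alpha> < 0" using Im0 less Imf[of s0] f1 by (auto simp: mult_neg_pos zero_less_mult_iff)
  \<comment> \<open>The second pentagon is the half turn of the first about the midpoint of the
    edge, which is the map taking \<open>x\<close> to \<open>1 - x\<close> in edge coordinates; so
    the rectangle lemma applies to it with \<open>1 - f s2\<close>.\<close>
  have f2: "of_real s2 = q + u * (1 + zeta5) + (- u) + (- u) * (zeta5 - 1) * (1 - f s2)"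
    unfolding fe[of s2] by (simp add: e_def algebra_simps)
  have Im2: "Im (f s2) < 0" using Im\<alpha> less Imf[of s2] f1 by (simp add: mult_pos_neg)
  have n2: "\<not> (0 < Re (f s2) \<and> Re (f s2) < 1 \<and> - Im (f s2) < 1/2)"
    using pentagon_interior_strip[of "- u" "1 - f s2" "q + u * (1 + zeta5)"] u s2(2) f2 Im2 by auto
  have bnd: "\<bar>Im (f s)\<bar> \<le> \<bar>s - s1\<bar>" for s
    using \<alpha>(2) Imf[of s] f1 by (simp add: abs_mult mult_left_le)
  \<comment> \<open>If one end has height at least 1/2, the speed bound suffices. Otherwise both
    ends lie beyond the lateral sides of the rectangle; as \<open>Re (f s)\<close> is monotone and
    takes the value \<open>t\<close> strictly between 0 and 1 at \<open>s1\<close>, they lie beyond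
    opposite sides and are at least 1 apart.\<close>
  show ?thesis
  proof (cases "Im (f s0) \<ge> 1/2 \<or> - Im (f s2) \<ge> 1/2")
    case True
    then show ?thesis using bnd[of s0] bnd[of s2] less by auto
  next
    case False
    then have out: "Re (f s0) \<le> 0 \<or> Re (f s0) \<ge> 1" "Re (f s2) \<le> 0 \<or> Re (f s2) \<ge> 1"
      using n0 n2 by auto
    have R: "Re (f s0) = t + (s0 - s1) * Re \<alpha>" "Re (f s2) = t + (s2 - s1) * Re \<alpha>"
      using Ref f1 by auto
    have "\<bar>Re (f s2) - Re (f s0)\<bar> \<ge> 1"
    proof (cases "Re \<alpha> \<ge> 0")
      case True
      then have "(s0 - s1) * Re \<alpha> \<le> 0" "(s2 - s1) * Re \<alpha> \<ge> 0"
        using less by (auto simp: mult_nonpos_nonneg)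
      then show ?thesis using out R t by linarith
    next
      case False
      then have "(s0 - s1) * Re \<alpha> \<ge> 0" "(s2 - s1) * Re \<alpha> \<le> 0"
        using less by (auto simp: mult_nonpos_nonpos mult_nonneg_nonpos)
      then show ?thesis using out R t by linarith
    qed
    also have "Re (f s2) - Re (f s0) = (s2 - s0) * Re \<alpha>" using R by (simp add: algebra_simps)
    also have "\<bar>(s2 - s0) * Re \<alpha>\<bar> \<le> s2 - s0" using \<alpha>(1) less by (simp add: abs_mult mult_left_le)
    finally show ?thesis by simp
  qed
qed

section \<open>Cyclotomic integers with bounded coefficients\<close>

definition zeta5_lattice :: "nat \<Rightarrow> complex set" where
  "zeta5_lattice n = {\<Sum>i<5. of_int (m i) * zeta5 ^ i | m. \<forall>i<5. \<bar>m i\<bar> \<le> int n}"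

lemma zero_in_zeta5_lattice: "0 \<in> zeta5_lattice n"
  unfolding zeta5_lattice_def by (auto intro!: exI[of _ "\<lambda>_. 0"])

lemma zeta5_lattice_uminus: "x \<in> zeta5_lattice n \<Longrightarrow> - x \<in> zeta5_lattice n"
  unfolding zeta5_lattice_def
proof safe
  fix m :: "nat \<Rightarrow> int" assume "\<forall>i<5. \<bar>m i\<bar> \<le> int n"
  then show "\<exists>m'. - (\<Sum>i<5. of_int (m i) * zeta5 ^ i) = (\<Sum>i<5. of_int (m' i) * zeta5 ^ i) \<and>
      (\<forall>i<5. \<bar>m' i\<bar> \<le> int n)"
    by (intro exI[of _ "\<lambda>i. - m i"]) (auto simp: sum_negf)
qed

text \<open>All five powers are kept in the definition, in spite of the relation
  \<open>zeta5_sum\<close>, so that adding any power changes one coefficient by one. The price is a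
  count of order \<open>n ^ 5\<close>.\<close>

lemma zeta5_lattice_add_power: 
  assumes "x \<in> zeta5_lattice n" shows "x + zeta5 ^ k \<in> zeta5_lattice (Suc n)"
proof -
  obtain m where m: "x = (\<Sum>i<5. of_int (m i) * zeta5 ^ i)" "\<forall>i<5. \<bar>m i\<bar> \<le> int n"
    using assms by (auto simp: zeta5_lattice_def)
  define m' where "m' = (\<lambda>i. m i + (if i = k mod 5 then 1 else 0))"
  have "(\<Sum>i<5. of_int (m' i) * zeta5 ^ i)
      = (\<Sum>i<5. of_int (m i) * zeta5 ^ i + (if i = k mod 5 then zeta5 ^ i else 0))"
    by (rule sum.cong) (auto simp: m'_def algebra_simps)
  also have "\<dots> = x + zeta5 ^ k" by (simp add: sum.distrib m(1) flip: zeta5_pow_mod)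
  finally have "x + zeta5 ^ k = (\<Sum>i<5. of_int (m' i) * zeta5 ^ i)" by simp
  moreover have "\<forall>i<5. \<bar>m' i\<bar> \<le> int (Suc n)"
  proof (intro allI impI)
    fix i :: nat assume "i < 5"
    then have "\<bar>m i\<bar> \<le> int n" using m(2) by blast
    then show "\<bar>m' i\<bar> \<le> int (Suc n)" by (auto simp: m'_def)
  qed
  ultimately show ?thesis unfolding zeta5_lattice_def by blast
qed

lemma zeta5_lattice_diff_power:
  assumes "x \<in> zeta5_lattice n" shows "x - zeta5 ^ k \<in> zeta5_lattice (Suc n)"
  using zeta5_lattice_uminus[OF zeta5_lattice_add_power[OF zeta5_lattice_uminus[OF assms], of k]] by simp

lemma zeta5_lattice_add_sign_power:
  "x \<in> zeta5_lattice n \<Longrightarrow> \<sigma> \<in> {1, -1} \<Longrightarrow> x + \<sigma> * zeta5 ^ k \<in> zeta5_lattice (Suc n)"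
  using zeta5_lattice_add_power[of x n k] zeta5_lattice_diff_power[of x n k] by auto

lemma zeta5_lattice_mono: "m \<le> n \<Longrightarrow> zeta5_lattice m \<subseteq> zeta5_lattice n"
  unfolding zeta5_lattice_def by force

lemma finite_zeta5_lattice: "finite (zeta5_lattice n)"
  and card_zeta5_lattice_le: "card (zeta5_lattice n) \<le> (2 * n + 1) ^ 5"
proof -
  let ?M = "{..<5::nat} \<rightarrow>\<^sub>E {- int n..int n}"
  have sub: "zeta5_lattice n \<subseteq> (\<lambda>m. \<Sum>i<5. of_int (m i) * zeta5 ^ i) ` ?M"
  proof
    fix x assume "x \<in> zeta5_lattice n"
    then obtain m where m: "x = (\<Sum>i<5. of_int (m i) * zeta5 ^ i)" "\<forall>i<5. \<bar>m i\<bar> \<le> int n"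
      by (auto simp: zeta5_lattice_def)
    show "x \<in> (\<lambda>m. \<Sum>i<5. of_int (m i) * zeta5 ^ i) ` ?M"
      by (rule image_eqI[of _ _ "restrict m {..<5}"]) (use m in \<open>auto simp: abs_le_iff\<close>)
  qed
  have fin: "finite ?M" by (intro finite_PiE) auto
  show "finite (zeta5_lattice n)" by (rule finite_subset[OF sub]) (use fin in simp)
  have "card (zeta5_lattice n) \<le> card ?M" by (rule surj_card_le[OF fin sub])
  also have "card ?M = (2 * n + 1) ^ 5" by (simp add: card_PiE nat_add_distrib nat_mult_distrib)
  finally show "card (zeta5_lattice n) \<le> (2 * n + 1) ^ 5" .
qed


section \<open>Unfolding\<close>

definition plane_isometry :: "(complex \<Rightarrow> complex) \<Rightarrow> bool" where
  "plane_isometry T \<longleftrightarrow>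
     (\<exists>p U. norm U = 1 \<and> (T = (\<lambda>z. p + U * z) \<or> T = (\<lambda>z. p + U * cnj z)))"

lemma plane_isometry_affine:
  "plane_isometry T \<Longrightarrow> T ((1 - t) *\<^sub>R x + t *\<^sub>R y) = (1 - t) *\<^sub>R T x + t *\<^sub>R T y"
  unfolding plane_isometry_def by (auto simp: scaleR_conv_of_real algebra_simps)

lemma plane_isometry_dist: 
  assumes "plane_isometry T" shows "dist (T x) (T y) = dist x y"
proof -
  obtain p U where U: "norm U = 1" "T = (\<lambda>z. p + U * z) \<or> T = (\<lambda>z. p + U * cnj z)"
    using assms by (auto simp: plane_isometry_def)
  have "norm (U * x - U * y) = norm (x - y)" "norm (U * cnj x - U * cnj y) = norm (x - y)"
    using U(1) by (simp_all add: norm_mult flip: right_diff_distrib complex_cnj_diff)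
  then show ?thesis using U(2) by (auto simp: dist_norm)
qed

lemma plane_isometry_line:
  assumes "plane_isometry T" "norm w = 1"
  obtains z' w' where "norm w' = 1" "\<And>x::real. T (z + x *\<^sub>R w) = z' + x *\<^sub>R w'"
proof -
  obtain p U where U: "norm U = 1" "T = (\<lambda>z. p + U * z) \<or> T = (\<lambda>z. p + U * cnj z)"
    using assms by (auto simp: plane_isometry_def)
  from U(2) show ?thesis
  proof
    assume T: "T = (\<lambda>z. p + U * z)"
    show ?thesis
      by (rule that[of "U * w" "p + U * z"]) (use U assms T in \<open>auto simp: norm_mult algebra_simps\<close>)
  next
    assume T: "T = (\<lambda>z. p + U * cnj z)"
    show ?thesis
      by (rule that[of "U * cnj w" "p + U * cnj z"])
         (use U assms T in \<open>auto simp: norm_mult scaleR_conv_of_real algebra_simps\<close>)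
  qed
qed

lemma plane_isometry_pentagon:
  assumes "plane_isometry T"
  obtains q' u' where "T ` pentagon q u = pentagon q' u'" "norm u' = norm u"
proof -
  obtain p U where U: "norm U = 1" "T = (\<lambda>z. p + U * z) \<or> T = (\<lambda>z. p + U * cnj z)"
    using assms by (auto simp: plane_isometry_def)
  then show ?thesis
    using that[of "p + U * q" "U * u"] that[of "p + U * cnj q" "U * cnj u"]
    by (auto simp: pentagon_image pentagon_image_cnj norm_mult)
qed

text \<open>Two circles centered on the real axis meet in conjugate points.\<close>

lemma equidistant_from_0_1:
  fixes b y :: complex
  assumes "norm b = norm y" "norm (b - 1) = norm (y - 1)"
  shows "b = y \<or> b = cnj y"
proof -
  have 1: "(Re b)^2 + (Im b)^2 = (Re y)^2 + (Im y)^2"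
    using assms(1) by (metis cmod_power2)
  have 2: "(Re b - 1)^2 + (Im b)^2 = (Re y - 1)^2 + (Im y)^2"
    using assms(2) cmod_power2[of "b - 1"] cmod_power2[of "y - 1"] by simp
  have "Re b = Re y" using 1 2 by (simp add: power2_eq_square algebra_simps)
  moreover from this have "Im b = Im y \<or> Im b = - Im y" using 1 by (simp add: power2_eq_iff)
  ultimately show ?thesis by (auto simp: complex_eq_iff)
qed

text \<open>Normalising two points of \<open>S\<close> and their images to 0 and 1 leaves for every
  other point a choice between its coordinate and the conjugate. One point that is really conjugated
  forces the choice for all others through the distances to it. \<open>S\<close> is arbitrary
  because the part of a facet covered by a chart has no known shape.\<close>

lemma isometry_on_extends_to_plane:
  fixes f :: "complex \<Rightarrow> complex"
  assumes iso: "\<And>x y. x \<in> S \<Longrightarrow> y \<in> S \<Longrightarrow> dist (f x) (f y) = dist x y"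
  obtains T where "plane_isometry T" "\<And>x. x \<in> S \<Longrightarrow> T x = f x"
proof (cases "\<exists>x0\<in>S. \<exists>x1\<in>S. x0 \<noteq> x1")
  case False
  obtain c where c: "\<And>x. x \<in> S \<Longrightarrow> x = c" using False by metis
  show ?thesis
  proof (rule that)
    show "plane_isometry (\<lambda>z. (f c - c) + 1 * z)"
      unfolding plane_isometry_def by (metis norm_one)
  qed (use c in fastforce)
next
  case True
  then obtain x0 x1 where x: "x0 \<in> S" "x1 \<in> S" "x0 \<noteq> x1" by blast
  define y where "y = (\<lambda>x. (x - x0) / (x1 - x0))"
  define b where "b = (\<lambda>x. (f x - f x0) / (f x1 - f x0))"
  have nz: "norm (f x1 - f x0) = norm (x1 - x0)" using iso[OF x(2,1)] by (simp add: dist_norm)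
  then have nz': "f x1 - f x0 \<noteq> 0" "x1 - x0 \<noteq> 0" using x(3) by auto
  have diff: "norm (b x - b x') = norm (y x - y x')" if "x \<in> S" "x' \<in> S" for x x'
  proof -
    have "b x - b x' = (f x - f x') / (f x1 - f x0)" "y x - y x' = (x - x') / (x1 - x0)"
      by (simp_all add: b_def y_def diff_divide_distrib)
    then show ?thesis using iso[OF that] nz by (simp add: norm_divide dist_norm)
  qed
  have b01: "b x0 = 0" "b x1 = 1" "y x0 = 0" "y x1 = 1" using nz' by (simp_all add: b_def y_def)
  have alt: "b x = y x \<or> b x = cnj (y x)" if "x \<in> S" for x
    using equidistant_from_0_1[of "b x" "y x"] diff[OF that x(1)] diff[OF that x(2)] b01 by simp
  have f: "f x = f x0 + (f x1 - f x0) * b x" for x using nz' by (simp add: b_def)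
  define U where "U = (f x1 - f x0) / (x1 - x0)"
  define U' where "U' = (f x1 - f x0) / cnj (x1 - x0)"
  have U: "norm U = 1" "norm U' = 1" using nz nz' by (simp_all add: U_def U'_def norm_divide complex_mod_cnj del: complex_cnj_diff)
  show ?thesis
  proof (cases "\<forall>x\<in>S. b x = y x")
    case True
    show ?thesis
    proof (rule that[of "\<lambda>z. (f x0 - U * x0) + U * z"])
      show "plane_isometry (\<lambda>z. (f x0 - U * x0) + U * z)" using U by (auto simp: plane_isometry_def)
      fix x assume "x \<in> S"
      then have "f x = f x0 + (f x1 - f x0) * y x" using f[of x] True by simp
      then show "(f x0 - U * x0) + U * x = f x"
        by (simp add: U_def y_def diff_divide_distrib algebra_simps)
    qed
  next
    case False
    then obtain x2 where x2: "x2 \<in> S" "b x2 \<noteq> y x2" by blast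
    then have bx2: "b x2 = cnj (y x2)" using alt by blast
    then have im: "Im (y x2) \<noteq> 0" using x2(2) by (auto simp: complex_eq_iff)
    have all: "b x = cnj (y x)" if "x \<in> S" for x
    proof (rule ccontr)
      assume n: "b x \<noteq> cnj (y x)"
      then have "b x = y x" using alt that by blast
      then have "(norm (y x - cnj (y x2)))^2 = (norm (y x - y x2))^2"
        using diff[OF that x2(1)] bx2 by simp
      then have "Im (y x) * Im (y x2) = 0"
        unfolding cmod_power2 by (simp add: power2_eq_square algebra_simps)
      then have "y x = cnj (y x)" using im by (auto simp: complex_eq_iff)
      then show False using n \<open>b x = y x\<close> by simp
    qed
    show ?thesis
    proof (rule that[of "\<lambda>z. (f x0 - U' * cnj x0) + U' * cnj z"])
      show "plane_isometry (\<lambda>z. (f x0 - U' * cnj x0) + U' * cnj z)"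
        using U by (auto simp: plane_isometry_def)
      fix x assume "x \<in> S"
      then have "f x = f x0 + (f x1 - f x0) * cnj (y x)" using f[of x] all by simp
      then show "(f x0 - U' * cnj x0) + U' * cnj x = f x"
        by (simp add: U'_def y_def diff_divide_distrib algebra_simps)
    qed
  qed
qed

text \<open>Affinity is demanded everywhere, so that segments can be mapped without membership
  conditions; isometry is demanded on \<open>F\<close> only, since a map to the plane can be
  isometric only on a flat set.\<close>

definition unfolds :: "'a::euclidean_space set \<Rightarrow> ('a \<Rightarrow> complex) \<Rightarrow> bool" where
  "unfolds F A \<longleftrightarrow> (\<forall>x y t. A ((1 - t) *\<^sub>R x + t *\<^sub>R y) = (1 - t) *\<^sub>R A x + t *\<^sub>R A y) \<and>
     (\<forall>x\<in>F. \<forall>y\<in>F. dist (A x) (A y) = dist x y)"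

lemma unfolds_affine: "unfolds F A \<Longrightarrow> A ((1 - t) *\<^sub>R x + t *\<^sub>R y) = (1 - t) *\<^sub>R A x + t *\<^sub>R A y"
  by (simp add: unfolds_def)

lemma unfolds_dist: "unfolds F A \<Longrightarrow> x \<in> F \<Longrightarrow> y \<in> F \<Longrightarrow> dist (A x) (A y) = dist x y"
  by (simp add: unfolds_def)

lemma unfolds_inj_on: "unfolds F A \<Longrightarrow> inj_on A F"
proof (rule inj_onI)
  fix x y assume "unfolds F A" "x \<in> F" "y \<in> F" "A x = A y"
  then show "x = y" using unfolds_dist[of F A x y] by simp
qed

lemma unfolds_continuous_on: "unfolds F A \<Longrightarrow> continuous_on F A"
  unfolding continuous_on_iff by (auto simp: unfolds_dist)

lemma unfolds_compose: "unfolds F A \<Longrightarrow> plane_isometry T \<Longrightarrow> unfolds F (\<lambda>x. T (A x))"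
  by (simp add: unfolds_def plane_isometry_affine plane_isometry_dist)

lemma unfolds_closed_segment: "unfolds F A \<Longrightarrow> A ` closed_segment a b = closed_segment (A a) (A b)"
  by (simp add: closed_segment_image_interval image_image unfolds_affine[of F])

lemma unfolds_open_segment:
  "unfolds F A \<Longrightarrow> x \<in> open_segment a b \<Longrightarrow> A a \<noteq> A b \<Longrightarrow> A x \<in> open_segment (A a) (A b)"
  unfolding in_segment by (auto simp: unfolds_affine)

lemma unfolds_face:
  assumes A: "unfolds F A" and "convex F" and E: "E face_of F"
  shows "A ` E face_of A ` F"
proof -
  have sub: "E \<subseteq> F" "convex E" using E face_of_imp_subset face_of_imp_convex by blast+
  have "convex (A ` E)"
    unfolding convex_alt
  proof safe
    fix x y u assume "x \<in> E" "y \<in> E" "0 \<le> (u::real)" "u \<le> 1"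
    then have "(1 - u) *\<^sub>R x + u *\<^sub>R y \<in> E" using sub(2) by (simp add: convex_alt)
    then show "(1 - u) *\<^sub>R A x + u *\<^sub>R A y \<in> A ` E"
      using unfolds_affine[OF A] by (metis imageI)
  qed
  moreover have "x \<in> E \<and> y \<in> E" if xy: "x \<in> F" "y \<in> F" "z \<in> E" "A z \<in> open_segment (A x) (A y)" for x y z
  proof -
    obtain t where t: "0 < t" "t < 1" "A z = (1 - t) *\<^sub>R A x + t *\<^sub>R A y" "A x \<noteq> A y"
      using xy(4) by (auto simp: in_segment)
    define z' where "z' = (1 - t) *\<^sub>R x + t *\<^sub>R y"
    have "z' \<in> F" using \<open>convex F\<close> xy t by (simp add: convex_alt z'_def)
    moreover have "A z' = A z" by (simp add: z'_def unfolds_affine[OF A] t(3))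
    ultimately have "z' = z" using unfolds_inj_on[OF A] sub xy by (auto dest: inj_onD)
    moreover have "z' \<in> open_segment x y" using t by (auto simp: in_segment z'_def)
    ultimately show ?thesis using face_ofD[OF E _ xy(1,2)] xy(3) by blast
  qed
  ultimately show ?thesis unfolding face_of_def using sub(1) by blast
qed

text \<open>Coordinates in the orthonormal frame of the pentagon's plane, with the center as origin,
  turn its vertices into \<open>r * zeta5 ^ k\<close>.\<close>

lemma regular_pentagon_unfolding:
  assumes "regular_polygon 5 1 F"
  obtains A u where "unfolds F A" "A ` F = pentagon 0 u" "norm (u * (zeta5 - 1)) = 1"
proof -
  obtain c u v r p where uv: "norm u = 1" "norm v = 1" "u \<bullet> v = 0" and "r > 0" and
    p: "\<And>k::nat. p k = c + (r * cos (2 * pi * real k / 5)) *\<^sub>R u + (r * sin (2 * pi * real k / 5)) *\<^sub>R v"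
    and F: "F = convex hull (p ` {..<5})" and d: "dist (p 0) (p 1) = 1"
    using assms unfolding regular_polygon_def by auto
  have dot: "u \<bullet> u = 1" "v \<bullet> v = 1" "v \<bullet> u = 0"
    using uv by (simp_all add: norm_eq_1 inner_commute)
  define l where "l = (\<lambda>x. Complex (x \<bullet> u) (x \<bullet> v))"
  define A where "A = (\<lambda>x. l x - l c)"
  have lin: "linear l" by (auto intro!: linearI simp: l_def complex_eq_iff inner_add_left)
  have A_comb: "A (c + a *\<^sub>R u + b *\<^sub>R v) = Complex a b" for a b
    using uv dot by (simp add: A_def l_def complex_eq_iff inner_add_left)
  have Ap: "A (p k) = of_real r * zeta5 ^ k" for k
  proof -
    have "zeta5 ^ k = cis (real k * (2 * pi / 5))" by (simp only: zeta5_def Complex.DeMoivre)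
    also have "real k * (2 * pi / 5) = 2 * pi * real k / 5" by simp
    finally show ?thesis unfolding p A_comb by (simp add: complex_eq_iff)
  qed
  define P where "P = {c + a *\<^sub>R u + b *\<^sub>R v | a b. True}"
  have "convex P" unfolding convex_alt
  proof safe
    fix x y t assume "x \<in> P" "y \<in> P"
    then obtain a b a' b' where "x = c + a *\<^sub>R u + b *\<^sub>R v" "y = c + a' *\<^sub>R u + b' *\<^sub>R v"
      by (auto simp: P_def)
    then have "(1 - t) *\<^sub>R x + t *\<^sub>R y = c + ((1-t)*a + t*a') *\<^sub>R u + ((1-t)*b + t*b') *\<^sub>R v"
      by (simp add: algebra_simps)
    then show "(1 - t) *\<^sub>R x + t *\<^sub>R y \<in> P" unfolding P_def by blast
  qed
  then have FP: "F \<subseteq> P" unfolding F by (intro hull_minimal) (auto simp: p P_def)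
  have distP: "dist (A x) (A y) = dist x y" if xy: "x \<in> P" "y \<in> P" for x y
  proof -
    obtain a b a' b' where e: "x = c + a *\<^sub>R u + b *\<^sub>R v" "y = c + a' *\<^sub>R u + b' *\<^sub>R v"
      using xy by (auto simp: P_def)
    have "x - y = (a - a') *\<^sub>R u + (b - b') *\<^sub>R v" by (simp add: e algebra_simps)
    then have "(x - y) \<bullet> (x - y) = (a - a') * (a - a') + (b - b') * (b - b')"
      using uv dot by (simp add: inner_add_left inner_add_right)
    then have "(norm (x - y))^2 = (a - a')^2 + (b - b')^2"
      by (simp only: power2_norm_eq_inner power2_eq_square[of "a - a'"] power2_eq_square[of "b - b'"])
    then have "(dist x y)^2 = (dist (A x) (A y))^2"
      by (simp add: dist_norm e A_comb cmod_power2)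
    then show ?thesis by (metis power2_eq_iff_nonneg zero_le_dist)
  qed
  have "unfolds F A"
    unfolding unfolds_def
  proof (intro conjI allI ballI)
    fix x y t
    show "A ((1 - t) *\<^sub>R x + t *\<^sub>R y) = (1 - t) *\<^sub>R A x + t *\<^sub>R A y"
      unfolding A_def linear_add[OF lin] linear_scale[OF lin] by (simp add: algebra_simps)
  qed (use FP distP in blast)
  moreover have "A ` F = pentagon 0 (of_real r)"
  proof -
    have "A ` F = (+) (- l c) ` l ` F" by (simp add: A_def image_image)
    also have "\<dots> = convex hull ((+) (- l c) ` l ` p ` {..<5})"
      by (simp only: F convex_hull_linear_image[OF lin] convex_hull_translation)
    also have "(+) (- l c) ` l ` p ` {..<5} = (\<lambda>k. A (p k)) ` {..<5}"
      by (simp add: A_def image_image)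
    finally show ?thesis by (simp add: Ap pentagon_def)
  qed
  moreover have "norm (of_real r * (zeta5 - 1)) = 1"
  proof -
    have "p k \<in> P" if "k < 5" for k using FP unfolding F by (meson hull_inc imageI lessThan_iff subsetD that)
    then have "dist (A (p 0)) (A (p 1)) = 1" using distP[of "p 0" "p 1"] d by simp
    then show ?thesis by (simp add: Ap dist_norm norm_minus_commute algebra_simps)
  qed
  ultimately show ?thesis using that by blast
qed

text \<open>Replaces a chart, known only on the part \<open>S\<close> of a facet, by an affine map
  that makes sense on the whole facet.\<close>

lemma isometry_extends_to_unfolding:
  fixes h :: "'a::euclidean_space \<Rightarrow> complex"
  assumes F: "regular_polygon 5 1 F" and S: "S \<subseteq> F"
    and iso: "\<And>x y. x \<in> S \<Longrightarrow> y \<in> S \<Longrightarrow> dist (h x) (h y) = dist x y"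
  obtains A where "unfolds F A" "\<And>x. x \<in> S \<Longrightarrow> A x = h x"
proof -
  obtain A u where A: "unfolds F A" using regular_pentagon_unfolding[OF F] by metis
  have inj: "inj_on A S" using unfolds_inj_on[OF A] S by (rule inj_on_subset)
  obtain T where T: "plane_isometry T" "\<And>x. x \<in> A ` S \<Longrightarrow> T x = h (inv_into S A x)"
  proof (rule isometry_on_extends_to_plane[of "A ` S" "\<lambda>x. h (inv_into S A x)"])
    fix x y assume "x \<in> A ` S" "y \<in> A ` S"
    then show "dist (h (inv_into S A x)) (h (inv_into S A y)) = dist x y"
      using iso unfolds_dist[OF A] S inj by (auto simp: subset_iff)
  qed blast
  show ?thesis
    by (rule that[OF unfolds_compose[OF A T(1)]]) (use T(2) inj in auto)
qed

text \<open>On \<open>F\<close> any two unfoldings differ by a plane isometry, and reflections as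
  well as rotations preserve the shape \<open>pentagon q u\<close>.\<close>

lemma unfolds_pentagon:
  assumes F: "regular_polygon 5 1 F" and A: "unfolds F A"
  obtains q u where "A ` F = pentagon q u" "norm (u * (zeta5 - 1)) = 1"
proof -
  obtain B u where B: "unfolds F B" "B ` F = pentagon 0 u" "norm (u * (zeta5 - 1)) = 1"
    using regular_pentagon_unfolding[OF F] by metis
  have inj: "inj_on B F" by (rule unfolds_inj_on[OF B(1)])
  obtain T where T: "plane_isometry T" "\<And>x. x \<in> B ` F \<Longrightarrow> T x = A (inv_into F B x)"
  proof (rule isometry_on_extends_to_plane[of "B ` F" "\<lambda>x. A (inv_into F B x)"])
    fix x y assume "x \<in> B ` F" "y \<in> B ` F"
    then show "dist (A (inv_into F B x)) (A (inv_into F B y)) = dist x y"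
      using unfolds_dist[OF A] unfolds_dist[OF B(1)] inj by auto
  qed blast
  have "A ` F = T ` B ` F" using T(2) inj by (force simp: image_image)
  moreover obtain q' u' where "T ` pentagon 0 u = pentagon q' u'" "norm u' = norm u"
    by (rule plane_isometry_pentagon[OF T(1)])
  ultimately show ?thesis using that[of q' u'] B by (simp add: norm_mult)
qed

section \<open>Geodesics on polytopes with pentagonal facets\<close>

locale pentagonal_polytope =
  fixes D :: "(real^3) set"
  assumes polytope: "polytope D" and interior: "interior D \<noteq> {}"
    and pentagonal: "F facet_of D \<Longrightarrow> regular_polygon 5 1 F"
begin

lemma frontier_eq: "frontier D = \<Union> {F. F facet_of D}"
proof -
  have "rel_interior D = interior D" "closure D = D"
    using interior polytope by (simp_all add: rel_interior_nonempty_interior polytope_imp_closed)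
  then show ?thesis
    using rel_boundary_of_polyhedron[OF polytope_imp_polyhedron[OF polytope]]
    by (simp add: frontier_def)
qed

lemma facet_subset_frontier: "F facet_of D \<Longrightarrow> F \<subseteq> frontier D"
  using frontier_eq by blast

lemma facet_convex: "F facet_of D \<Longrightarrow> convex F"
  using facet_of_imp_face_of face_of_imp_convex by blast

lemma facet_compact: "F facet_of D \<Longrightarrow> compact F"
  using face_of_polytope_polytope[OF polytope] facet_of_imp_face_of polytope_imp_compact by blast

lemma facet_aff_dim: "F facet_of D \<Longrightarrow> aff_dim F = 2"
  using interior by (simp add: facet_of_def aff_dim_nonempty_interior)

lemma facets_not_subset:
  assumes "F facet_of D" "G facet_of D" "F \<noteq> G"
  shows "\<not> F \<subseteq> G"
proof
  assume "F \<subseteq> G"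
  then have "F face_of G"
    using assms face_of_face facet_of_imp_face_of by blast
  then have "aff_dim F < aff_dim G"
    using face_of_aff_dim_lt[OF facet_convex] assms by blast
  then show False using facet_aff_dim assms by simp
qed

lemma common_face:
  assumes "F facet_of D" "G facet_of D" "F \<noteq> G"
  shows "F \<inter> G face_of F" "F \<inter> G \<noteq> F"
proof -
  have "F \<inter> G face_of D" using assms by (simp add: face_of_Int facet_of_imp_face_of)
  then show "F \<inter> G face_of F" using assms by (simp add: face_of_face[OF facet_of_imp_face_of])
  show "F \<inter> G \<noteq> F" using facets_not_subset[OF assms] by blast
qed

text \<open>The intersection is a proper face of a polygon, so it has dimension at most 1 and is a
  segment. Its ends are vertices of \<open>D\<close>, so \<open>x\<close> is neither of
  them.\<close>

lemma common_edge:
  assumes "F facet_of D" "G facet_of D" "F \<noteq> G" and x: "x \<in> F" "x \<in> G" "x \<notin> vertices D"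
  obtains a b where "F \<inter> G = closed_segment a b" "x \<in> open_segment a b"
proof -
  have face: "F \<inter> G face_of D" using assms by (simp add: face_of_Int facet_of_imp_face_of)
  have "aff_dim (F \<inter> G) < aff_dim F"
    using face_of_aff_dim_lt[OF facet_convex common_face] assms by blast
  then have "aff_dim (F \<inter> G) \<le> 1" using facet_aff_dim assms by simp
  then have "collinear (F \<inter> G)" by (simp add: collinear_aff_dim)
  moreover have "compact (F \<inter> G)" "convex (F \<inter> G)"
    using assms facet_compact facet_convex by (simp_all add: compact_Int convex_Int)
  moreover have "F \<inter> G \<noteq> {}" using x by blast
  ultimately obtain a b where ab: "F \<inter> G = closed_segment a b"
    using compact_convex_collinear_segment by blast
  then have "a extreme_point_of D" "b extreme_point_of D"
    using extreme_point_of_face[OF face, of a] extreme_point_of_face[OF face, of b]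
    by (simp_all add: extreme_point_of_segment)
  then have "x \<noteq> a" "x \<noteq> b" using x by (auto simp: vertices_def)
  moreover have "x \<in> closed_segment a b" using x ab by blast
  ultimately show ?thesis using that ab by (simp add: open_segment_def)
qed

text \<open>The facets that miss \<open>x\<close> are finitely many closed sets, so their union
  keeps a positive distance from \<open>x\<close>.\<close>

lemma facet_near:
  assumes "x \<in> frontier D"
  obtains \<rho> where "\<rho> > 0"
    "\<And>y. y \<in> frontier D \<Longrightarrow> dist x y < \<rho> \<Longrightarrow> \<exists>F. F facet_of D \<and> x \<in> F \<and> y \<in> F"
proof -
  define K where "K = \<Union> {F. F facet_of D \<and> x \<notin> F}"
  have "closed K" unfolding K_def
    using finite_polytope_facets[OF polytope] facet_compact compact_imp_closed
    by (intro closed_Union) (auto intro: finite_subset)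
  moreover have "x \<notin> K" by (auto simp: K_def)
  ultimately obtain \<rho> where "\<rho> > 0" "ball x \<rho> \<inter> K = {}"
    by (metis Compl_iff closed_def disjoint_eq_subset_Compl inf_commute open_contains_ball)
  then show ?thesis using that[of \<rho>] frontier_eq by (fastforce simp: K_def)
qed

end

section \<open>Reading a geodesic in charts\<close>

definition isometric_chart :: "(real^3) set \<Rightarrow> (real^3) set \<Rightarrow> (real^3 \<Rightarrow> complex) \<Rightarrow> bool" where
  "isometric_chart D W h \<longleftrightarrow> openin (top_of_set (frontier D)) W \<and> inj_on h W \<and>
     (\<forall>F. F facet_of D \<longrightarrow> (\<forall>x\<in>W \<inter> F. \<forall>y\<in>W \<inter> F. dist (h x) (h y) = dist x y))"

lemma isometric_chart_compose:
  assumes h: "isometric_chart D W h" and T: "plane_isometry T"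
  shows "isometric_chart D W (\<lambda>x. T (h x))"
proof -
  have "inj_on (\<lambda>x. T (h x)) W"
  proof (rule inj_onI)
    fix x y assume xy: "x \<in> W" "y \<in> W" "T (h x) = T (h y)"
    then have "h x = h y" using plane_isometry_dist[OF T, of "h x" "h y"] by simp
    then show "x = y" using h xy by (auto simp: isometric_chart_def dest: inj_onD)
  qed
  then show ?thesis using h by (simp add: isometric_chart_def plane_isometry_dist[OF T])
qed

text \<open>A chart is known only near a point. Affine maps that agree at \<open>x\<close> and at a
  nearby point of the segment also agree at the far end \<open>y\<close>.\<close>

lemma segment_initial_points_near:
  fixes x y :: "'a::real_normed_vector"
  assumes "\<rho> > 0"
  obtains t where "0 < t" "t < 1" "dist x ((1 - t) *\<^sub>R x + t *\<^sub>R y) < \<rho>"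
proof -
  define M where "M = norm (y - x) + 1"
  have M: "M > 0" "norm (y - x) \<le> M" by (auto simp: M_def add_nonneg_pos)
  define t where "t = min (1/2) (\<rho> / (2 * M))"
  have t: "0 < t" "t < 1" using assms M by (auto simp: t_def)
  have "dist x ((1 - t) *\<^sub>R x + t *\<^sub>R y) = norm (t *\<^sub>R (y - x))"
    by (simp add: dist_norm norm_minus_commute algebra_simps)
  also have "\<dots> = t * norm (y - x)" using t by simp
  also have "\<dots> \<le> (\<rho> / (2 * M)) * M"
    by (intro mult_mono) (use assms M in \<open>auto simp: t_def\<close>)
  also have "\<dots> = \<rho> / 2" using M by simp
  also have "\<dots> < \<rho>" using assms by simp
  finally show ?thesis using that t by blast
qed

lemma complex_line_determined:
  fixes z w :: complex
  assumes "z + y1 *\<^sub>R w = of_real y1" "z + y2 *\<^sub>R w = of_real y2" "y1 \<noteq> y2"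
  shows "z + x *\<^sub>R w = of_real x"
proof -
  have "(y1 - y2) *\<^sub>R w = of_real (y1 - y2)"
  proof -
    have "(y1 - y2) *\<^sub>R w = (z + y1 *\<^sub>R w) - (z + y2 *\<^sub>R w)" by (simp add: algebra_simps)
    also have "\<dots> = of_real (y1 - y2)" by (simp only: assms of_real_diff)
    finally show ?thesis .
  qed
  then have "w = 1" using assms(3) by (simp add: scaleR_conv_of_real)
  then show ?thesis using assms(1) by (simp add: scaleR_conv_of_real)
qed

text \<open>A uniform motion with two positions on a segment moves along it, so from an inner point
  it cannot leave at once. This will exclude that a geodesic running along an edge exits the facet
  at an inner point of that edge.\<close>

lemma segment_extends_past_interior:
  fixes P Q :: "'a::real_vector" and x y :: real
  assumes "a < b" "z a \<in> closed_segment P Q" "z b \<in> open_segment P Q"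
    and line: "\<And>s. z s = z b + ((s - b) / (b - a)) *\<^sub>R (z b - z a)"
  obtains \<mu> where "\<mu> > 0" "\<And>s. b \<le> s \<Longrightarrow> s \<le> b + \<mu> \<Longrightarrow> z s \<in> closed_segment P Q"
proof -
  obtain x0 where x0: "0 \<le> x0" "x0 \<le> 1" "z a = (1 - x0) *\<^sub>R P + x0 *\<^sub>R Q"
    using assms(2) by (auto simp: in_segment)
  obtain x1 where x1: "0 < x1" "x1 < 1" "z b = (1 - x1) *\<^sub>R P + x1 *\<^sub>R Q"
    using assms(3) by (auto simp: in_segment)
  \<comment> \<open>The distance of the parameter \<open>x1\<close> from the ends of the unit
    interval; as \<open>\<bar>x1 - x0\<bar> \<le> 1\<close>, the motion may continue for the
    fraction \<open>m\<close> of the time \<open>b - a\<close>.\<close>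
  define m where "m = min x1 (1 - x1)"
  have m: "m > 0" using x1 by (simp add: m_def)
  show ?thesis
  proof (rule that[of "m * (b - a)"])
    show "m * (b - a) > 0" using m assms(1) by simp
    fix s assume s: "b \<le> s" "s \<le> b + m * (b - a)"
    define \<tau> where "\<tau> = (s - b) / (b - a)"
    have \<tau>: "0 \<le> \<tau>" "\<tau> \<le> m" using s assms(1) by (auto simp: \<tau>_def divide_simps)
    define x where "x = x1 + \<tau> * (x1 - x0)"
    have "\<bar>\<tau> * (x1 - x0)\<bar> \<le> m * 1"
      unfolding abs_mult by (rule mult_mono) (use \<tau> x0 x1 m in auto)
    then have x: "0 \<le> x" "x \<le> 1" by (auto simp: x_def m_def)
    have "z s = z b + \<tau> *\<^sub>R (z b - z a)" using line[of s] by (simp add: \<tau>_def)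
    also have "\<dots> = (1 - x) *\<^sub>R P + x *\<^sub>R Q"
      unfolding x0(3) x1(3) x_def by (simp add: algebra_simps)
    finally show "z s \<in> closed_segment P Q" using x by (auto simp: in_segment)
  qed
qed

locale geodesic = pentagonal_polytope +
  fixes g L a0 b0
  assumes geo: "geodesic_segment D g L a0 b0"
begin

lemma L_pos: "L > 0" and g_cont: "continuous_on {0..L} g" and g_frontier: "s \<in> {0..L} \<Longrightarrow> g s \<in> frontier D"
  and g_0: "g 0 = a0" and g_L: "g L = b0" and ends: "a0 \<in> vertices D" "b0 \<in> vertices D"
  and g_not_vertex: "0 < s \<Longrightarrow> s < L \<Longrightarrow> g s \<notin> vertices D"
  using geo unfolding geodesic_segment_def by auto

lemma chart_at:
  assumes "0 < s" "s < L"
  obtains W h \<epsilon> z w where "isometric_chart D W h" "\<epsilon> > 0" "norm w = 1" "{s-\<epsilon><..<s+\<epsilon>} \<subseteq> {0<..<L}"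
    "\<And>x. x \<in> {s-\<epsilon><..<s+\<epsilon>} \<Longrightarrow> g x \<in> W \<and> h (g x) = z + x *\<^sub>R w"
proof -
  have "s \<in> {0<..<L}" using assms by simp
  then obtain W h \<epsilon> z w where *: "flat_chart D W h" "\<epsilon> > 0" "norm w = 1" "{s-\<epsilon><..<s+\<epsilon>} \<subseteq> {0<..<L}"
    "\<forall>x\<in>{s-\<epsilon><..<s+\<epsilon>}. g x \<in> W \<and> h (g x) = z + x *\<^sub>R w"
    using geo unfolding geodesic_segment_def by meson
  moreover have "isometric_chart D W h" using *(1) by (simp add: flat_chart_def isometric_chart_def)
  ultimately show ?thesis using that by blast
qed

text \<open>Composing with a plane isometry, the chart can be made to agree with a given unfolding of a
  facet.\<close>
lemma adapted_chart_at:
  assumes s: "0 < s" "s < L" and F: "F facet_of D" "unfolds F A"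
  obtains W h \<epsilon> z w where "isometric_chart D W h" "\<epsilon> > 0" "norm w = 1" "{s-\<epsilon><..<s+\<epsilon>} \<subseteq> {0<..<L}"
    "\<And>x. x \<in> {s-\<epsilon><..<s+\<epsilon>} \<Longrightarrow> g x \<in> W \<and> h (g x) = z + x *\<^sub>R w"
    "\<And>y. y \<in> W \<Longrightarrow> y \<in> F \<Longrightarrow> h y = A y"
proof -
  obtain W h \<epsilon> z w where c: "isometric_chart D W h" "\<epsilon> > 0" "norm w = 1" "{s-\<epsilon><..<s+\<epsilon>} \<subseteq> {0<..<L}"
    "\<And>x. x \<in> {s-\<epsilon><..<s+\<epsilon>} \<Longrightarrow> g x \<in> W \<and> h (g x) = z + x *\<^sub>R w"
    using chart_at[OF s] by metis
  let ?S = "W \<inter> F"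
  have inj: "inj_on h ?S" using c(1) by (auto simp: isometric_chart_def intro: inj_on_subset)
  obtain T where T: "plane_isometry T" "\<And>x. x \<in> h ` ?S \<Longrightarrow> T x = A (inv_into ?S h x)"
  proof (rule isometry_on_extends_to_plane[of "h ` ?S" "\<lambda>x. A (inv_into ?S h x)"])
    fix x y assume "x \<in> h ` ?S" "y \<in> h ` ?S"
    then obtain x' y' where xy: "x' \<in> ?S" "y' \<in> ?S" "x = h x'" "y = h y'" by blast
    then show "dist (A (inv_into ?S h x)) (A (inv_into ?S h y)) = dist x y"
      using unfolds_dist[OF F(2)] c(1) F(1) by (simp add: inv_into_f_f[OF inj] isometric_chart_def)
  qed blast
  obtain z' w' where w': "norm w' = 1" "\<And>x::real. T (z + x *\<^sub>R w) = z' + x *\<^sub>R w'"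
    using plane_isometry_line[OF T(1) c(3)] by metis
  show ?thesis
  proof (rule that[of W "\<lambda>x. T (h x)" \<epsilon> w' z'])
    show "isometric_chart D W (\<lambda>x. T (h x))" by (rule isometric_chart_compose[OF c(1) T(1)])
    show "T (h y) = A y" if "y \<in> W" "y \<in> F" for y
      using T(2)[of "h y"] inv_into_f_f[OF inj, of y] that by simp
  qed (use c w' in auto)
qed

section \<open>Entering, traversing and leaving a facet\<close>

lemma chart_ball:
  assumes "isometric_chart D W h" "x \<in> W"
  obtains \<rho> where "\<rho> > 0" "\<And>y. y \<in> frontier D \<Longrightarrow> dist x y < \<rho> \<Longrightarrow> y \<in> W"
proof -
  have "openin (top_of_set (frontier D)) W" using assms(1) by (simp add: isometric_chart_def)
  then obtain \<rho> where "\<rho> > 0" "ball x \<rho> \<inter> frontier D \<subseteq> W"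
    using assms(2) unfolding openin_contains_ball by blast
  then show ?thesis using that[of \<rho>] by (auto simp: subset_iff)
qed

text \<open>A point shortly after \<open>g s\<close> shares a facet with it, but the points in
  between might lie elsewhere. In the chart, however, the chord inside the facet and the geodesic
  trace the same straight segment, so injectivity of the chart makes them equal.\<close>

lemma enters_facet:
  assumes s: "0 < s" "s < L"
  obtains F \<eta> where "F facet_of D" "\<eta> > 0" "s + \<eta> < L" "g ` {s..s+\<eta>} \<subseteq> F"
proof -
  obtain W h \<epsilon> z w where c: "isometric_chart D W h" "\<epsilon> > 0" "{s-\<epsilon><..<s+\<epsilon>} \<subseteq> {0<..<L}"
    "\<And>x. x \<in> {s-\<epsilon><..<s+\<epsilon>} \<Longrightarrow> g x \<in> W \<and> h (g x) = z + x *\<^sub>R w"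
    using chart_at[OF s] by metis
  have gW: "g s \<in> W" using c(4)[of s] c(2) by simp
  obtain \<rho> where \<rho>: "\<rho> > 0" "\<And>y. y \<in> frontier D \<Longrightarrow> dist (g s) y < \<rho> \<Longrightarrow> y \<in> W"
    using chart_ball[OF c(1) gW] by metis
  obtain \<rho>' where \<rho>': "\<rho>' > 0"
    "\<And>y. y \<in> frontier D \<Longrightarrow> dist (g s) y < \<rho>' \<Longrightarrow> \<exists>F. F facet_of D \<and> g s \<in> F \<and> y \<in> F"
    using facet_near[OF g_frontier[of s]] s by auto
  obtain \<delta> where \<delta>: "\<delta> > 0" "\<And>y. y \<in> {0..L} \<Longrightarrow> dist y s < \<delta> \<Longrightarrow> dist (g y) (g s) < min \<rho> \<rho>'"
    using g_cont s \<rho>(1) \<rho>'(1) unfolding continuous_on_iff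
    by (metis atLeastAtMost_iff less_eq_real_def min_less_iff_conj)
  define \<eta> where "\<eta> = min \<delta> \<epsilon> / 2"
  have \<eta>: "0 < \<eta>" "\<eta> < \<delta>" "\<eta> < \<epsilon>" using \<delta>(1) c(2) by (auto simp: \<eta>_def)
  have in\<epsilon>: "y \<in> {s-\<epsilon><..<s+\<epsilon>}" if "y \<in> {s..s+\<eta>}" for y using that \<eta> c(2) by auto
  then have in0L: "y \<in> {0<..<L}" if "y \<in> {s..s+\<eta>}" for y using that c(3) by blast
  let ?y = "g (s + \<eta>)"
  have yL: "s + \<eta> \<in> {0<..<L}" using in0L[of "s + \<eta>"] \<eta> by simp
  have near: "dist (g s) ?y < \<rho>" "dist (g s) ?y < \<rho>'" and fr: "?y \<in> frontier D"
    using \<delta>(2)[of "s + \<eta>"] yL \<eta> g_frontier[of "s + \<eta>"] by (auto simp: dist_commute dist_real_def)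
  obtain F where F: "F facet_of D" "g s \<in> F" "?y \<in> F" using \<rho>'(2)[OF fr near(2)] by blast
  obtain A where A: "unfolds F A" "\<And>x. x \<in> W \<inter> F \<Longrightarrow> A x = h x"
    using isometry_extends_to_unfolding[OF pentagonal[OF F(1)], of "W \<inter> F" h] c(1) F(1)
    unfolding isometric_chart_def by blast
  have "g x \<in> F" if x: "x \<in> {s..s+\<eta>}" for x
  proof -
    define t where "t = (x - s) / \<eta>"
    have t: "0 \<le> t" "t \<le> 1" "x = s + t * \<eta>" using x \<eta> by (auto simp: t_def)
    define f where "f = (1 - t) *\<^sub>R g s + t *\<^sub>R ?y"
    have fF: "f \<in> F" using facet_convex[OF F(1)] F t unfolding f_def by (simp add: convex_alt)
    have "dist (g s) f = t * dist (g s) ?y"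
    proof -
      have "g s - f = t *\<^sub>R (g s - ?y)" by (simp add: f_def algebra_simps)
      then show ?thesis using t by (simp add: dist_norm)
    qed
    also have "\<dots> \<le> dist (g s) ?y" using t by (simp add: mult_left_le_one_le)
    finally have fW: "f \<in> W" using \<rho>(2) near fF facet_subset_frontier[OF F(1)] by auto
    have "h f = A f" using A(2) fF fW by simp
    also have "\<dots> = (1 - t) *\<^sub>R h (g s) + t *\<^sub>R h ?y"
      using A(2)[of "g s"] A(2)[of ?y] F gW c(4)[OF in\<epsilon>, of "s + \<eta>"] \<eta>
      unfolding f_def unfolds_affine[OF A(1)] by simp
    also have "\<dots> = z + x *\<^sub>R w"
      using c(4)[OF in\<epsilon>, of s] c(4)[OF in\<epsilon>, of "s + \<eta>"] \<eta> unfolding t(3)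
      by (simp add: algebra_simps)
    also have "\<dots> = h (g x)" using c(4)[OF in\<epsilon>[OF x]] by simp
    finally have "f = g x"
      using c(1) c(4)[OF in\<epsilon>[OF x]] fW inj_onD[of h W f "g x"] by (simp add: isometric_chart_def)
    then show ?thesis using fF by simp
  qed
  then show ?thesis using that[OF F(1) \<eta>(1)] yL by (auto simp: image_subset_iff)
qed

text \<open>Only says that times outside \<open>F\<close> occur arbitrarily soon after
  \<open>b\<close>; that is what an infimum of such times provides.\<close>

definition exits :: "(real^3) set \<Rightarrow> real \<Rightarrow> bool" where
  "exits F b \<longleftrightarrow> (\<forall>\<eta>>0. \<exists>y. b < y \<and> y < b + \<eta> \<and> y \<le> L \<and> g y \<notin> F)"

text \<open>\<open>b\<close> is the infimum of the later times spent outside \<open>F\<close>;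
  closedness of \<open>F\<close> keeps \<open>g b\<close> inside.\<close>

lemma maximal_stay:
  assumes F: "closed F" and s: "0 \<le> s" "s < s'" "s' \<le> L" and sub: "g ` {s..s'} \<subseteq> F"
  obtains b where "s' \<le> b" "b \<le> L" "g ` {s..b} \<subseteq> F" "b < L \<Longrightarrow> exits F b"
proof (cases "\<exists>x. s' \<le> x \<and> x \<le> L \<and> g x \<notin> F")
  case False
  then have "g ` {s..L} \<subseteq> F" using sub by (force simp: image_subset_iff)
  then show ?thesis using that[of L] s by simp
next
  case True
  define X where "X = {x. s' \<le> x \<and> x \<le> L \<and> g x \<notin> F}"
  have X: "X \<noteq> {}" "bdd_below X" using True by (auto simp: X_def)
  define b where "b = Inf X"
  have b: "s' \<le> b" unfolding b_def by (rule cInf_greatest) (use X in \<open>auto simp: X_def\<close>)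
  have bL: "b \<le> L"
  proof -
    obtain x where "x \<in> X" using X by blast
    then have "b \<le> x" "x \<le> L" using cInf_lower[OF _ X(2)] by (auto simp: b_def X_def)
    then show ?thesis by simp
  qed
  have below: "g y \<in> F" if "s \<le> y" "y < b" for y
  proof (cases "y \<le> s'")
    case True
    then show ?thesis using sub that by auto
  next
    case False
    have "y \<notin> X" using cInf_lower[OF _ X(2), of y] that by (auto simp: b_def)
    then show ?thesis using False that bL by (auto simp: X_def)
  qed
  have "closed {y \<in> {s..b}. g y \<in> F}"
  proof -
    have "continuous_on {s..b} g" using g_cont by (rule continuous_on_subset) (use s bL in auto)
    then have "closed ({s..b} \<inter> g -` F)" by (intro continuous_closed_preimage F) auto
    then show ?thesis by (simp add: Int_def vimage_def)
  qed
  moreover have "{s..<b} \<subseteq> {y \<in> {s..b}. g y \<in> F}" using below by auto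
  ultimately have "closure {s..<b} \<subseteq> {y \<in> {s..b}. g y \<in> F}" by (rule closure_minimal[rotated])
  then have stay: "g ` {s..b} \<subseteq> F" using s b by auto
  have "exits F b" unfolding exits_def
  proof (intro allI impI)
    fix \<eta> :: real assume "\<eta> > 0"
    then obtain y where y: "y \<in> X" "y < b + \<eta>" using cInf_lessD[OF X(1), of "b + \<eta>"] by (auto simp: b_def)
    moreover have "b \<le> y" using cInf_lower[OF y(1) X(2)] by (simp add: b_def)
    moreover have "y \<noteq> b" using stay s b y(1) by (auto simp: X_def image_subset_iff)
    ultimately show "\<exists>y. b < y \<and> y < b + \<eta> \<and> y \<le> L \<and> g y \<notin> F"
      by (intro exI[of _ y]) (auto simp: X_def)
  qed
  then show ?thesis using that b bL stay by blast
qed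

text \<open>In a chart adapted to \<open>A\<close>, the image of the geodesic is an affine line,
  which is fixed by two of its points. So the equation spreads from a neighbourhood of
  \<open>c\<close> over the open interval by connectedness, and to its ends, where charts may be
  missing, by continuity.\<close>

lemma straight_in_facet:
  assumes F: "F facet_of D" "unfolds F A" and ab: "0 \<le> a" "b \<le> L" "g ` {a..b} \<subseteq> F"
    and c: "a < c" "c < b" "\<eta> > 0" "\<And>y. y \<in> {a..b} \<Longrightarrow> \<bar>y - c\<bar> < \<eta> \<Longrightarrow> A (g y) = of_real y"
    and y: "y \<in> {a..b}"
  shows "A (g y) = of_real y"
proof -
  define P where "P x \<longleftrightarrow> (\<exists>\<eta>>0. \<forall>y\<in>{a..b}. \<bar>y - x\<bar> < \<eta> \<longrightarrow> A (g y) = of_real y)" for x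
  have P: "P x" if "x \<in> {a<..<b}" for x
  proof (rule connected_induction_simple[of "{a<..<b}" c])
    show "connected {a<..<b}" by simp
    show "P c" unfolding P_def using c by blast
    fix s assume s: "s \<in> {a<..<b}"
    then have "0 < s" "s < L" using ab by auto
    then obtain W h \<epsilon> z w where k: "isometric_chart D W h" "\<epsilon> > 0"
      "\<And>x. x \<in> {s-\<epsilon><..<s+\<epsilon>} \<Longrightarrow> g x \<in> W \<and> h (g x) = z + x *\<^sub>R w"
      "\<And>y. y \<in> W \<Longrightarrow> y \<in> F \<Longrightarrow> h y = A y"
      using adapted_chart_at[OF _ _ F] by metis
    have line: "A (g x) = z + x *\<^sub>R w" if "x \<in> {a..b}" "x \<in> {s-\<epsilon><..<s+\<epsilon>}" for x
      using k(3)[OF that(2)] k(4)[of "g x"] ab(3) that(1) by (auto simp: image_subset_iff)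
    define T where "T = {a<..<b} \<inter> {s-\<epsilon><..<s+\<epsilon>}"
    have const: "P x''" if T': "x' \<in> T" "x'' \<in> T" "P x'" for x' x''
    proof -
      obtain \<eta>' where \<eta>': "\<eta>' > 0" "\<And>y. y \<in> {a..b} \<Longrightarrow> \<bar>y - x'\<bar> < \<eta>' \<Longrightarrow> A (g y) = of_real y"
        using \<open>P x'\<close> by (auto simp: P_def)
      have "open T" by (auto simp: T_def)
      then obtain d where d: "d > 0" "ball x' d \<subseteq> T" using T' by (meson open_contains_ball)
      obtain d' where d': "d' > 0" "ball x'' d' \<subseteq> T" using \<open>open T\<close> T' by (meson open_contains_ball)
      define y1 where "y1 = x' + min d \<eta>' / 2"
      have y1: "y1 \<in> T" "\<bar>y1 - x'\<bar> < \<eta>'" "y1 \<noteq> x'"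
        using d \<eta>'(1) by (auto simp: y1_def dist_real_def intro!: subsetD[OF d(2)])
      have "z + y1 *\<^sub>R w = of_real y1" "z + x' *\<^sub>R w = of_real x'"
        using line[of y1] line[of x'] \<eta>'(2)[of y1] \<eta>'(2)[of x'] y1 \<eta>'(1) T'(1) by (auto simp: T_def)
      then have all: "z + x *\<^sub>R w = of_real x" for x using complex_line_determined y1(3) by blast
      have "A (g y) = of_real y" if "\<bar>y - x''\<bar> < d'" for y
      proof -
        have "y \<in> T" using d' that by (auto simp: dist_real_def subset_iff)
        then show ?thesis using line[of y] all by (simp add: T_def)
      qed
      then show ?thesis using d'(1) by (auto simp: P_def)
    qed
    have openT: "openin (top_of_set {a<..<b}) T" unfolding T_def by (rule openin_open_Int) simp
    have "s \<in> T" using s k(2) by (auto simp: T_def)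
    show "\<exists>T. openin (top_of_set {a<..<b}) T \<and> s \<in> T \<and> (\<forall>x\<in>T. \<forall>y\<in>T. P x \<longrightarrow> P y)"
      by (intro exI[of _ T] conjI ballI impI openT \<open>s \<in> T\<close>) (rule const)
  qed (use c that in auto)
  have inner: "A (g x) = of_real x" if "x \<in> {a<..<b}" for x using P[OF that] that unfolding P_def by force
  have cont: "continuous_on {a..b} (\<lambda>x. A (g x))"
    by (rule continuous_on_compose2[OF unfolds_continuous_on[OF F(2)] continuous_on_subset[OF g_cont]])
       (use ab in auto)
  have "closed ({a..b} \<inter> (\<lambda>x. A (g x) - of_real x) -` {0})"
    by (intro continuous_closed_preimage continuous_on_diff cont continuous_intros)
  then have "closed {x \<in> {a..b}. A (g x) = of_real x}"
    by (simp add: Int_def vimage_def)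
  moreover have "{a<..<b} \<subseteq> {x \<in> {a..b}. A (g x) = of_real x}" using inner by auto
  ultimately have "closure {a<..<b} \<subseteq> {x \<in> {a..b}. A (g x) = of_real x}" by (rule closure_minimal[rotated])
  then show ?thesis using y c by auto
qed

lemma unfold_along:
  assumes F: "F facet_of D" and ab: "0 \<le> a" "a < b" "b \<le> L" "g ` {a..b} \<subseteq> F"
  obtains A where "unfolds F A" "\<And>y. y \<in> {a..b} \<Longrightarrow> A (g y) = of_real y"
proof -
  obtain B where B: "unfolds F B" using regular_pentagon_unfolding[OF pentagonal[OF F]] by metis
  define c where "c = (a + b) / 2"
  have c: "a < c" "c < b" "0 < c" "c < L" using ab by (auto simp: c_def)
  obtain W h \<epsilon> z w where k: "\<epsilon> > 0" "norm w = 1"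
    "\<And>x. x \<in> {c-\<epsilon><..<c+\<epsilon>} \<Longrightarrow> g x \<in> W \<and> h (g x) = z + x *\<^sub>R w"
    "\<And>y. y \<in> W \<Longrightarrow> y \<in> F \<Longrightarrow> h y = B y"
    using adapted_chart_at[OF c(3,4) F B] by metis
  have w: "w \<noteq> 0" using k(2) by auto
  \<comment> \<open>The inverse of the line that sends \<open>y\<close> to
    \<open>z + y *\<^sub>R w\<close>.\<close>
  define T where "T = (\<lambda>\<xi>. - z / w + (1 / w) * \<xi>)"
  have T: "plane_isometry T" unfolding plane_isometry_def T_def
    using k(2) by (intro exI[of _ "- z / w"] exI[of _ "1 / w"]) (simp add: norm_divide)
  have TB: "unfolds F (\<lambda>x. T (B x))" by (rule unfolds_compose[OF B T])
  have "T (B (g y)) = of_real y" if "y \<in> {a..b}" "\<bar>y - c\<bar> < \<epsilon>" for y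
  proof -
    have "B (g y) = z + y *\<^sub>R w"
    proof -
      have "y \<in> {c-\<epsilon><..<c+\<epsilon>}" using that by (auto simp: abs_diff_less_iff)
      then show ?thesis
        using k(3)[of y] k(4)[of "g y"] that(1) ab(4) by (auto simp: image_subset_iff)
    qed
    then show ?thesis using w by (simp add: T_def scaleR_conv_of_real field_simps)
  qed
  then show ?thesis
    using that[OF TB] straight_in_facet[OF F TB ab(1,3,4) c(1,2) k(1)] by blast
qed

text \<open>Both unfoldings come from one chart at \<open>g b\<close>. Hence they agree on the
  common points near \<open>g b\<close>, and by affinity on all of \<open>F \<inter> G\<close>. If
  their images coincided, a point of \<open>F\<close> outside \<open>G\<close> close to
  \<open>g b\<close> would have the same chart image as a point of \<open>G\<close>, contradicting
  injectivity: the unfolding does not fold back.\<close>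

lemma exit_step:
  assumes F: "F facet_of D" "unfolds F A" and ab: "0 \<le> a" "a < b" "b < L" "g ` {a..b} \<subseteq> F"
    and A: "\<And>y. y \<in> {a..b} \<Longrightarrow> A (g y) = of_real y" and exit: "exits F b"
  obtains G B \<eta> where "G facet_of D" "G \<noteq> F" "\<eta> > 0" "b + \<eta> \<le> L" "g ` {b..b+\<eta>} \<subseteq> G"
    "unfolds G B" "\<And>y. y \<in> {b..b+\<eta>} \<Longrightarrow> B (g y) = of_real y"
    "\<And>x. x \<in> F \<inter> G \<Longrightarrow> B x = A x" "B ` G \<noteq> A ` F"
proof -
  have b: "0 < b" "b < L" using ab by auto
  obtain W h \<epsilon> z w where c: "isometric_chart D W h" "\<epsilon> > 0" "norm w = 1" "{b-\<epsilon><..<b+\<epsilon>} \<subseteq> {0<..<L}"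
    "\<And>x. x \<in> {b-\<epsilon><..<b+\<epsilon>} \<Longrightarrow> g x \<in> W \<and> h (g x) = z + x *\<^sub>R w"
    "\<And>y. y \<in> W \<Longrightarrow> y \<in> F \<Longrightarrow> h y = A y"
    using adapted_chart_at[OF b F] by metis
  have gF: "g y \<in> F" if "y \<in> {a..b}" for y using ab(4) that by auto
  have W: "g b \<in> W" "g b \<in> F" using c(2) c(5)[of b] gF ab by auto
  have hg: "h (g x) = of_real x" if "x \<in> {b-\<epsilon><..<b+\<epsilon>}" for x
  proof -
    \<comment> \<open>A time other than \<open>b\<close> at which both the chart and
      \<open>A\<close> are available; together with \<open>b\<close> it determines the line.\<close>
    define y1 where "y1 = max a (b - \<epsilon>/2)"
    have y1: "y1 \<in> {a..b}" "y1 \<in> {b-\<epsilon><..<b+\<epsilon>}" "y1 \<noteq> b" using c(2) ab by (auto simp: y1_def)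
    have "z + y1 *\<^sub>R w = of_real y1"
      using c(5)[OF y1(2)] c(6)[of "g y1"] gF[OF y1(1)] A[OF y1(1)] by simp
    moreover have "z + b *\<^sub>R w = of_real b"
      using c(5)[of b] c(2) c(6)[OF W] A[of b] ab by simp
    ultimately have "z + x *\<^sub>R w = of_real x" using complex_line_determined y1(3) by blast
    then show ?thesis using c(5)[OF that] by simp
  qed
  obtain G \<eta>0 where G: "G facet_of D" "\<eta>0 > 0" "b + \<eta>0 < L" "g ` {b..b+\<eta>0} \<subseteq> G"
    using enters_facet[OF b] by metis
  have "G \<noteq> F"
  proof
    assume "G = F"
    obtain y where "b < y" "y < b + \<eta>0" "g y \<notin> F" using exit G(2) unfolding exits_def by blast
    then show False using G(4) \<open>G = F\<close> by (auto simp: image_subset_iff)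
  qed
  obtain B where B: "unfolds G B" "\<And>x. x \<in> W \<inter> G \<Longrightarrow> B x = h x"
    using isometry_extends_to_unfolding[OF pentagonal[OF G(1)], of "W \<inter> G" h] c(1) G(1)
    unfolding isometric_chart_def by blast
  define \<eta> where "\<eta> = min \<eta>0 (\<epsilon>/2)"
  have \<eta>: "\<eta> > 0" "\<eta> \<le> \<eta>0" "\<eta> < \<epsilon>" using G(2) c(2) by (auto simp: \<eta>_def)
  have sub: "g ` {b..b+\<eta>} \<subseteq> G" using G(4) \<eta> by (auto simp: image_subset_iff)
  have gbG: "g b \<in> G" using sub \<eta> by auto
  have Bg: "B (g y) = of_real y" if "y \<in> {b..b+\<eta>}" for y
  proof -
    have y: "y \<in> {b-\<epsilon><..<b+\<epsilon>}" using that \<eta> c(2) by auto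
    then show ?thesis using B(2)[of "g y"] c(5)[OF y] hg[OF y] sub that by (auto simp: image_subset_iff)
  qed
  obtain \<rho> where \<rho>: "\<rho> > 0" "\<And>y. y \<in> frontier D \<Longrightarrow> dist (g b) y < \<rho> \<Longrightarrow> y \<in> W"
    using chart_ball[OF c(1) W(1)] by metis
  have agree: "B x = A x" if x: "x \<in> F \<inter> G" for x
  proof -
    obtain t where t: "0 < t" "t < 1" "dist (g b) ((1 - t) *\<^sub>R g b + t *\<^sub>R x) < \<rho>"
      using segment_initial_points_near[OF \<rho>(1)] by metis
    define f where "f = (1 - t) *\<^sub>R g b + t *\<^sub>R x"
    have f: "f \<in> F" "f \<in> G"
      using facet_convex[OF F(1)] facet_convex[OF G(1)] x W gbG t by (auto simp: convex_alt f_def)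
    then have fW: "f \<in> W" using \<rho>(2) t(3) facet_subset_frontier[OF F(1)] by (auto simp: f_def)
    have "B f = A f" using B(2)[of f] c(6)[OF fW] f fW by simp
    moreover have "B (g b) = A (g b)" using B(2)[of "g b"] c(6)[OF W] gbG W by simp
    ultimately have "t *\<^sub>R B x = t *\<^sub>R A x"
      unfolding f_def unfolds_affine[OF F(2)] unfolds_affine[OF B(1)] by simp
    then show ?thesis using t by simp
  qed
  have "B ` G \<noteq> A ` F"
  proof
    assume eq: "B ` G = A ` F"
    obtain f where f: "f \<in> F" "f \<notin> G" using facets_not_subset[OF F(1) G(1)] \<open>G \<noteq> F\<close> by blast
    obtain t where t: "0 < t" "t < 1" "dist (g b) ((1 - t) *\<^sub>R g b + t *\<^sub>R f) < \<rho>"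
      using segment_initial_points_near[OF \<rho>(1)] by metis
    define f' where "f' = (1 - t) *\<^sub>R g b + t *\<^sub>R f"
    have f'F: "f' \<in> F" using facet_convex[OF F(1)] W f t by (simp add: convex_alt f'_def)
    have f'W: "f' \<in> W" using \<rho>(2) t(3) f'F facet_subset_frontier[OF F(1)] by (auto simp: f'_def)
    have "g b \<noteq> f" using f gbG by auto
    then have seg: "f' \<in> open_segment (g b) f" using t by (auto simp: in_segment f'_def)
    have "f' \<notin> G"
    proof
      assume "f' \<in> G"
      then have "f \<in> F \<inter> G"
        using face_ofD[OF common_face(1)[OF F(1) G(1)] seg W(2) f(1)] f'F \<open>G \<noteq> F\<close> by blast
      then show False using f by simp
    qed
    obtain y where y: "y \<in> G" "A f' = B y" using eq f'F by (metis imageE imageI)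
    have "dist (g b) y = dist (B (g b)) (B y)" using unfolds_dist[OF B(1) gbG y(1)] by simp
    also have "B (g b) = A (g b)" using agree W gbG by blast
    also have "dist (A (g b)) (B y) = dist (g b) f'"
      using unfolds_dist[OF F(2) W(2) f'F] y(2) by simp
    finally have "y \<in> W" using \<rho>(2) t(3) y(1) facet_subset_frontier[OF G(1)] by (auto simp: f'_def)
    then have "h y = h f'" using B(2)[of y] c(6)[OF f'W f'F] y by simp
    then have "y = f'" using c(1) \<open>y \<in> W\<close> f'W inj_onD[of h W y f'] by (simp add: isometric_chart_def)
    then show False using y(1) \<open>f' \<notin> G\<close> by simp
  qed
  then show ?thesis
    using that[OF G(1) \<open>G \<noteq> F\<close> \<eta>(1) _ sub B(1) Bg agree] G(3) \<eta>(2) by simp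
qed

text \<open>The common points form a proper face, and a proper face misses the interior.\<close>

lemma edge_point_not_interior:
  assumes F: "F facet_of D" "unfolds F A" and "G facet_of D" "G \<noteq> F" "x \<in> F" "x \<in> G"
  shows "A x \<notin> interior (A ` F)"
proof -
  have face: "F \<inter> G face_of F" "F \<inter> G \<noteq> F" using common_face assms by auto
  have "A ` (F \<inter> G) \<noteq> A ` F"
    using inj_on_image_eq_iff[OF unfolds_inj_on[OF F(2)], of "F \<inter> G" F] face by auto
  then show ?thesis
    using face_of_disjoint_interior[OF unfolds_face[OF F(2) facet_convex[OF F(1)] face(1)]] assms by blast
qed

text \<open>The two unfolded pentagons share the crossed edge and differ, so the second is a half
  turn of the first. The remaining claims are those needed to bound the lengths of two successive
  chords from below.\<close>

lemma crossing:
  assumes F: "F facet_of D" "unfolds F A" and ab: "0 \<le> a" "a < b" "b < L" "g ` {a..b} \<subseteq> F"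
    and A: "\<And>y. y \<in> {a..b} \<Longrightarrow> A (g y) = of_real y" and exit: "exits F b"
    and P: "A ` F = pentagon q u" "u \<noteq> 0"
  obtains G B \<eta> i u' where "G facet_of D" "\<eta> > 0" "b + \<eta> \<le> L" "g ` {b..b+\<eta>} \<subseteq> G"
    "unfolds G B" "\<forall>y\<in>{b..b+\<eta>}. B (g y) = of_real y"
    "u' = u * zeta5 ^ i" "B ` G = pentagon (q + u' * (1 + zeta5)) (- u')"
    "of_real b \<in> open_segment (q + u') (q + u' * zeta5)"
    "of_real a \<notin> closed_segment (q + u') (q + u' * zeta5)"
    "of_real b \<notin> interior (A ` F)" "of_real b \<notin> interior (B ` G)"
proof -
  obtain G B \<eta> where G: "G facet_of D" "G \<noteq> F" "\<eta> > 0" "b + \<eta> \<le> L" "g ` {b..b+\<eta>} \<subseteq> G"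
    "unfolds G B" "\<And>y. y \<in> {b..b+\<eta>} \<Longrightarrow> B (g y) = of_real y"
    "\<And>x. x \<in> F \<inter> G \<Longrightarrow> B x = A x" "B ` G \<noteq> A ` F"
    using exit_step[OF F ab A exit] by metis
  have gb: "g b \<in> F" "g b \<in> G" "A (g b) = of_real b" "B (g b) = of_real b"
    using ab G(3,5,7) A by auto
  obtain p p' where E: "F \<inter> G = closed_segment p p'" "g b \<in> open_segment p p'"
    using common_edge[OF F(1) G(1) G(2)[symmetric] gb(1,2) g_not_vertex] ab by auto
  have pF: "p \<in> F" "p' \<in> F" "p \<noteq> p'" using E by auto
  have ne: "A p \<noteq> A p'" using unfolds_inj_on[OF F(2)] pF by (auto dest: inj_onD)
  have AE: "A ` (F \<inter> G) = closed_segment (A p) (A p')"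
    unfolding E(1) by (rule unfolds_closed_segment[OF F(2)])
  have BE: "B ` (F \<inter> G) = closed_segment (A p) (A p')" using AE G(8) by (metis image_cong)
  have faceA: "closed_segment (A p) (A p') face_of pentagon q u"
    using unfolds_face[OF F(2) facet_convex[OF F(1)] common_face(1)[OF F(1) G(1) G(2)[symmetric]]]
    unfolding AE P(1) .
  obtain q2 u2 where P2: "B ` G = pentagon q2 u2" "norm (u2 * (zeta5 - 1)) = 1"
    using unfolds_pentagon[OF pentagonal[OF G(1)] G(6)] by metis
  have faceB: "closed_segment (A p) (A p') face_of pentagon q2 u2"
    using unfolds_face[OF G(6) facet_convex[OF G(1)] common_face(1)[OF G(1) F(1) G(2)]] BE
    by (simp add: P2(1) Int_commute)
  have u2: "u2 \<noteq> 0" and ne2: "pentagon q2 u2 \<noteq> pentagon q u" using P2 P(1) G(9) by auto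
  obtain i u' where u': "u' = u * zeta5 ^ i"
    "closed_segment (A p) (A p') = closed_segment (q + u') (q + u' * zeta5)"
    "open_segment (A p) (A p') = open_segment (q + u') (q + u' * zeta5)"
    "B ` G = pentagon (q + u' * (1 + zeta5)) (- u')"
    using pentagons_sharing_edge[OF faceA faceB ne P(2) u2] ne2 P2(1) by metis
  have bopen: "of_real b \<in> open_segment (A p) (A p')"
    using unfolds_open_segment[OF F(2) E(2) ne] gb(3) by simp
  \<comment> \<open>A chord starting on the edge it leaves through would run along that edge and
    remain on it for a while after \<open>b\<close>, hence in \<open>F\<close>, against
    \<open>exits F b\<close>.\<close>
  have "of_real a \<notin> closed_segment (A p) (A p')"
  proof
    assume "of_real a \<in> closed_segment (A p) (A p')"
    then obtain \<mu> where \<mu>: "\<mu> > 0"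
      "\<And>s. b \<le> s \<Longrightarrow> s \<le> b + \<mu> \<Longrightarrow> (of_real s :: complex) \<in> closed_segment (A p) (A p')"
    proof (rule segment_extends_past_interior[where z = "of_real :: real \<Rightarrow> complex", OF ab(2) _ bopen])
      fix s
      have "of_real b + ((s - b) / (b - a)) *\<^sub>R (of_real b - of_real a) =
          (of_real (b + ((s - b) / (b - a)) * (b - a)) :: complex)"
        by (simp add: scaleR_conv_of_real)
      also have "\<dots> = of_real s" using ab(2) by simp
      finally show "of_real s = of_real b + ((s - b) / (b - a)) *\<^sub>R (of_real b - of_real a :: complex)" by simp
    qed blast
    obtain s where s: "b < s" "s < b + min \<mu> \<eta>" "g s \<notin> F"
      using exit \<mu>(1) G(3) unfolding exits_def by (metis min_less_iff_conj)
    then have "of_real s \<in> B ` (F \<inter> G)" using \<mu>(2)[of s] BE by simp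
    then obtain e where e: "e \<in> F" "e \<in> G" "B e = of_real s" by auto
    have gs: "g s \<in> G" "B (g s) = of_real s" using G(5) G(7)[of s] s by (auto simp: image_subset_iff)
    have "g s = e" using inj_onD[OF unfolds_inj_on[OF G(6)]] gs e by simp
    then show False using s e by simp
  qed
  moreover have "of_real b \<notin> interior (A ` F)" "of_real b \<notin> interior (B ` G)"
    using edge_point_not_interior[OF F G(1,2) gb(1,2)] edge_point_not_interior[OF G(1,6) F(1) G(2)[symmetric] gb(2,1)]
      gb(3,4) by simp_all
  ultimately show ?thesis
    using that[OF G(1) G(3) G(4) G(5) G(6) ballI[OF G(7)] u'(1) u'(4)] bopen unfolding u'(2,3) by blast
qed

section \<open>The chain of unfolded facets along a geodesic\<close>

text \<open>The \<open>n\<close>-th facet of the unfolding, traversed during \<open>[a, b]\<close>. Crossing an edge is a half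
  turn of the pentagon about the midpoint of that edge, which adds two signed powers of \<open>zeta5\<close> to the
  lattice coordinate of the center; hence \<open>2 * n\<close>. The bounds on \<open>a\<close> and \<open>b\<close> hold because two
  consecutive chords, the first one of the geodesic excepted, have total length at least \<open>1/2\<close>.\<close>
definition chain :: "complex \<Rightarrow> complex \<Rightarrow> nat \<Rightarrow> (real^3) set \<Rightarrow> (real^3 \<Rightarrow> complex) \<Rightarrow>
    complex \<Rightarrow> complex \<Rightarrow> real \<Rightarrow> real \<Rightarrow> bool" where
  "chain q0 u0 n F A q u a b \<longleftrightarrow> F facet_of D \<and> unfolds F A \<and> A ` F = pentagon q u \<and>
     (\<exists>\<sigma>\<in>{1, -1}. \<exists>i. u = u0 * (\<sigma> * zeta5 ^ i)) \<and> (\<exists>x\<in>zeta5_lattice (2 * n). q = q0 + u0 * x) \<and>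
     0 \<le> a \<and> a < b \<and> b \<le> L \<and> g ` {a..b} \<subseteq> F \<and> (\<forall>y\<in>{a..b}. A (g y) = of_real y) \<and>
     (n > 0 \<longrightarrow> of_real a \<notin> interior (A ` F)) \<and> real n - 2 \<le> 4 * a \<and>
     (b < L \<longrightarrow> exits F b \<and> real n - 1 \<le> 4 * b)"

lemma chain_start:
  assumes F: "F facet_of D" and s: "0 \<le> s" "s < s'" "s' \<le> L" "g ` {s..s'} \<subseteq> F"
  obtains A q u b where "chain q u 0 F A q u s b" "norm (u * (zeta5 - 1)) = 1"
proof -
  obtain b where b: "s' \<le> b" "b \<le> L" "g ` {s..b} \<subseteq> F" "b < L \<Longrightarrow> exits F b"
    using maximal_stay[OF compact_imp_closed[OF facet_compact[OF F]] s] by metis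
  have sb: "s < b" using s b by simp
  obtain A where A: "unfolds F A" "\<And>y. y \<in> {s..b} \<Longrightarrow> A (g y) = of_real y"
    using unfold_along[OF F s(1) sb b(2,3)] by metis
  obtain q u where P: "A ` F = pentagon q u" "norm (u * (zeta5 - 1)) = 1"
    using unfolds_pentagon[OF pentagonal[OF F] A(1)] by metis
  have "\<exists>\<sigma>\<in>{1, -1}. \<exists>i. u = u * (\<sigma> * zeta5 ^ i)"
    by (intro bexI[of _ 1] exI[of _ 0]) auto
  moreover have "\<exists>x\<in>zeta5_lattice (2 * 0). q = q + u * x"
    by (rule bexI[OF _ zero_in_zeta5_lattice]) simp
  ultimately have "chain q u 0 F A q u s b"
    unfolding chain_def using F A P s sb b by auto
  then show ?thesis using that P by blast
qed

lemma chain_step: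
  assumes u0: "norm (u0 * (zeta5 - 1)) = 1" and ch: "chain q0 u0 n F A q u a b" and bL: "b < L"
  obtains G B q' u' c where "chain q0 u0 (Suc n) G B q' u' b c"
proof -
  have F: "F facet_of D" "unfolds F A" and P: "A ` F = pentagon q u"
    and ab: "0 \<le> a" "a < b" "b \<le> L" "g ` {a..b} \<subseteq> F" and Ag: "\<And>y. y \<in> {a..b} \<Longrightarrow> A (g y) = of_real y"
    and aint: "n > 0 \<Longrightarrow> of_real a \<notin> interior (A ` F)" and na: "real n - 2 \<le> 4 * a"
    and exit: "exits F b" and nb: "real n - 1 \<le> 4 * b"
    using ch bL unfolding chain_def by auto
  obtain \<sigma> i x where u: "\<sigma> \<in> {1, -1}" "u = u0 * (\<sigma> * zeta5 ^ i)"
    and q: "x \<in> zeta5_lattice (2 * n)" "q = q0 + u0 * x"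
    using ch unfolding chain_def by blast
  have nu: "norm (u * (zeta5 - 1)) = 1" "u \<noteq> 0" using u0 u by (auto simp: norm_mult norm_power)
  obtain G B \<eta> j u' where G: "G facet_of D" "\<eta> > 0" "b + \<eta> \<le> L" "g ` {b..b+\<eta>} \<subseteq> G"
    "unfolds G B" "\<forall>y\<in>{b..b+\<eta>}. B (g y) = of_real y"
    "u' = u * zeta5 ^ j" "B ` G = pentagon (q + u' * (1 + zeta5)) (- u')"
    "of_real b \<in> open_segment (q + u') (q + u' * zeta5)"
    "of_real a \<notin> closed_segment (q + u') (q + u' * zeta5)"
    "of_real b \<notin> interior (A ` F)" "of_real b \<notin> interior (B ` G)"
    by (rule crossing[OF F ab(1,2) bL ab(4) Ag exit P nu(2)], assumption, rule that, assumption+)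
  have b0: "0 \<le> b" "b < b + \<eta>" using ab G(2) by auto
  obtain c where c: "b + \<eta> \<le> c" "c \<le> L" "g ` {b..c} \<subseteq> G" "c < L \<Longrightarrow> exits G c"
    using maximal_stay[OF compact_imp_closed[OF facet_compact[OF G(1)]] b0 G(3,4)] by metis
  have bc: "b < c" using c G(2) by simp
  have Bg: "B (g y) = of_real y" if "y \<in> {b..c}" for y
  proof (rule straight_in_facet[OF G(1,5) b0(1) c(2,3) _ _ _ _ that])
    show "b < b + \<eta>/2" "b + \<eta>/2 < c" "\<eta>/2 > 0" using G(2) c(1) by auto
    show "B (g y) = of_real y" if "\<bar>y - (b + \<eta>/2)\<bar> < \<eta>/2" for y
      using that by (intro G(6)[rule_format]) (auto simp: abs_if split: if_splits)
  qed
  \<comment> \<open>Passing to \<open>Suc n\<close>, the old bound at \<open>b\<close> becomes the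
    new bound at the entry, so only the bound at the new exit is left:
    \<open>c - a \<ge> 1/2\<close> adds 2 to \<open>4 * a \<ge> real n - 2\<close>. For
    \<open>n = 0\<close> the start need not lie on the boundary of the pentagon, but then the bound
    is trivial.\<close>
  have nc: "real n \<le> 4 * c" if cL: "c < L"
  proof (cases "n = 0")
    case True then show ?thesis using ab bc by simp
  next
    case False
    obtain q2 u2 where P2: "B ` G = pentagon q2 u2" "norm (u2 * (zeta5 - 1)) = 1"
      using unfolds_pentagon[OF pentagonal[OF G(1)] G(5)] by metis
    \<comment> \<open>The next crossing, at \<open>c\<close>, is invoked only to learn that
      \<open>c\<close> lies on the boundary of the current pentagon.\<close>
    have cint: "of_real c \<notin> interior (B ` G)"
    proof -
      have "u2 \<noteq> 0" using P2 by auto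
      then show ?thesis
        using crossing[OF G(1,5) b0(1) bc cL c(3) Bg c(4)[OF cL] P2(1)] by metis
    qed
    have gac: "g a \<in> F" "g c \<in> G" using ab c bc by auto
    have "c - a \<ge> 1/2"
    proof (rule two_pentagon_crossing[of u' a b c q])
      show "norm (u' * (zeta5 - 1)) = 1" using nu by (simp add: G(7) norm_mult norm_power)
      have "pentagon q u' = A ` F" by (simp add: G(7) pentagon_rotate P)
      then show "of_real a \<in> pentagon q u'" "of_real a \<notin> interior (pentagon q u')"
        using aint False gac(1) Ag[of a] ab by force+
      show "of_real c \<in> pentagon (q + u' * (1 + zeta5)) (- u')"
        "of_real c \<notin> interior (pentagon (q + u' * (1 + zeta5)) (- u'))"
        using G(8) gac(2) Bg[of c] bc cint by force+
    qed (use ab bc G in auto)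
    then show ?thesis using na by simp
  qed
  have "- u' = u0 * (- \<sigma> * zeta5 ^ (i + j))" by (simp add: G(7) u(2) power_add)
  moreover have "- \<sigma> \<in> {1, -1}" using u(1) by auto
  ultimately have U: "\<exists>\<sigma>\<in>{1, -1}. \<exists>i. - u' = u0 * (\<sigma> * zeta5 ^ i)" by blast
  \<comment> \<open>The coordinate of the new center: the half turn adds
    \<open>u' * (1 + zeta5)\<close>, that is, two consecutive powers with the common sign
    \<open>\<sigma>\<close>.\<close>
  define x' where "x' = x + \<sigma> * zeta5 ^ (i + j) + \<sigma> * zeta5 ^ (Suc (i + j))"
  have "x' \<in> zeta5_lattice (Suc (Suc (2 * n)))"
    unfolding x'_def by (intro zeta5_lattice_add_sign_power q u)
  then have x': "x' \<in> zeta5_lattice (2 * Suc n)" by simp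
  have "q + u' * (1 + zeta5) = q0 + u0 * x'"
    by (simp add: x'_def q(2) G(7) u(2) power_add algebra_simps)
  then have Q: "\<exists>x\<in>zeta5_lattice (2 * Suc n). q + u' * (1 + zeta5) = q0 + u0 * x" using x' by blast
  have "chain q0 u0 (Suc n) G B (q + u' * (1 + zeta5)) (- u') b c"
    unfolding chain_def using G(1,5,8,12) U Q b0(1) bc c Bg nb nc by auto
  then show ?thesis using that by blast
qed

text \<open>A chain of index \<open>n\<close> that ends before \<open>L\<close> satisfies
  \<open>real n - 1 \<le> 4 * L\<close>, so such chains cannot exist for all
  \<open>n\<close>.\<close>

lemma chain_reaches_end:
  assumes u0: "norm (u0 * (zeta5 - 1)) = 1" and start: "chain q0 u0 0 F A q0 u0 s b"
  obtains n G B q u a where "chain q0 u0 n G B q u a L"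
proof -
  have step: "(\<exists>m G B q u a. chain q0 u0 m G B q u a L) \<or> (\<exists>G B q u a c. chain q0 u0 n G B q u a c \<and> c < L)" for n
  proof (induction n)
    case 0
    have "b \<le> L" using start by (simp add: chain_def)
    then show ?case using start by (cases "b = L") force+
  next
    case (Suc n)
    then show ?case
    proof
      assume "\<exists>G B q u a c. chain q0 u0 n G B q u a c \<and> c < L"
      then obtain G B q u a c where "chain q0 u0 n G B q u a c" "c < L" by blast
      then obtain G' B' q' u' c' where *: "chain q0 u0 (Suc n) G' B' q' u' c c'"
        using chain_step[OF u0] by metis
      then have "c' \<le> L" by (simp add: chain_def)
      then show ?thesis using * by (cases "c' = L") force+
    qed blast
  qed
  obtain n where n: "real n > 4 * L + 2" using reals_Archimedean2 by blast
  have "\<not> (chain q0 u0 n G B q u a c \<and> c < L)" for G B q u a c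
    using n by (auto simp: chain_def)
  then show ?thesis using step[of n] that by blast
qed

text \<open>Starting the chain at the midpoint, where a chart is at hand, avoids any local analysis
  at the end vertex: the last facet of the chain is the one wanted.\<close>

lemma final_facet:
  obtains F s where "F facet_of D" "0 \<le> s" "s < L" "g ` {s..L} \<subseteq> F"
proof -
  have "0 < L / 2" "L / 2 < L" using L_pos by auto
  then obtain F \<eta> where F: "F facet_of D" "\<eta> > 0" "L / 2 + \<eta> < L" "g ` {L/2..L/2+\<eta>} \<subseteq> F"
    using enters_facet by metis
  obtain A q u b where st: "chain q u 0 F A q u (L/2) b" "norm (u * (zeta5 - 1)) = 1"
    by (rule chain_start[OF F(1) _ _ _ F(4)]) (use F L_pos in auto)
  obtain n G B q' u' a where "chain q u n G B q' u' a L"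
    by (rule chain_reaches_end[OF st(2,1)])
  then show ?thesis using that[of G a] by (auto simp: chain_def)
qed

text \<open>Turns a final facet into an initial one.\<close>

lemma reversed: "geodesic D (\<lambda>s. g (L - s)) L b0 a0"
proof (unfold_locales, unfold geodesic_segment_def, intro conjI ballI)
  show "continuous_on {0..L} (\<lambda>s. g (L - s))"
    by (rule continuous_on_compose2[OF g_cont]) (auto intro!: continuous_intros)
  show "(\<lambda>s. g (L - s)) ` {0..L} \<subseteq> frontier D" using g_frontier by auto
  fix s assume s: "s \<in> {0<..<L}"
  then show "g (L - s) \<notin> vertices D" using g_not_vertex by simp
  have "L - s \<in> {0<..<L}" using s by simp
  then obtain W h \<epsilon> z w where c: "flat_chart D W h" "\<epsilon> > 0" "norm w = 1"
    "{L-s-\<epsilon><..<L-s+\<epsilon>} \<subseteq> {0<..<L}" "\<forall>x\<in>{L-s-\<epsilon><..<L-s+\<epsilon>}. g x \<in> W \<and> h (g x) = z + x *\<^sub>R w"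
    using geo unfolding geodesic_segment_def by meson
  show "\<exists>W h \<epsilon> z w. flat_chart D W h \<and> \<epsilon> > 0 \<and> norm w = 1 \<and> {s-\<epsilon><..<s+\<epsilon>} \<subseteq> {0<..<L} \<and>
      (\<forall>x\<in>{s-\<epsilon><..<s+\<epsilon>}. g (L - x) \<in> W \<and> h (g (L - x)) = z + x *\<^sub>R w)"
  proof (intro exI conjI ballI)
    show "flat_chart D W h" "\<epsilon> > 0" "norm (- w) = 1" using c by auto
    have mem: "L - x \<in> {L-s-\<epsilon><..<L-s+\<epsilon>}" if "x \<in> {s-\<epsilon><..<s+\<epsilon>}" for x using that by auto
    show "{s-\<epsilon><..<s+\<epsilon>} \<subseteq> {0<..<L}"
    proof
      fix x assume "x \<in> {s-\<epsilon><..<s+\<epsilon>}"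
      then have "L - x \<in> {0<..<L}" using mem c(4) by blast
      then show "x \<in> {0<..<L}" by simp
    qed
    fix x assume x: "x \<in> {s-\<epsilon><..<s+\<epsilon>}"
    show "g (L - x) \<in> W" using c(5) mem[OF x] by blast
    show "h (g (L - x)) = (z + L *\<^sub>R w) + x *\<^sub>R (- w)" using c(5) mem[OF x] by (simp add: algebra_simps)
  qed
qed (use L_pos ends g_0 g_L in auto)

section \<open>Lengths of segments as norms of cyclotomic integers\<close>

lemma vertex_of_unfolding:
  assumes F: "F facet_of D" "unfolds F A" "A ` F = pentagon q u" and x: "x \<in> F" "x \<in> vertices D"
  obtains k where "A x = q + u * zeta5 ^ k"
proof -
  have "{x} face_of F"
    using extreme_point_of_face[OF facet_of_imp_face_of[OF F(1)], of x] x
    by (simp add: vertices_def face_of_singleton)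
  then have "A x extreme_point_of pentagon q u"
    using unfolds_face[OF F(2) facet_convex[OF F(1)], of "{x}"] F(3) by (simp add: face_of_singleton)
  then show ?thesis using that extreme_point_of_pentagon by blast
qed

text \<open>The unfolding puts the two end vertices at 0 and \<open>L\<close>, so \<open>L\<close>
  is a difference of pentagon vertices; the scale \<open>norm u0\<close> is determined by the edge
  length 1.\<close>

lemma length_in_lattice:
  obtains n x where "x \<in> zeta5_lattice (2 * n + 2)" "real n \<le> 4 * L + 2" "L = norm x / norm (zeta5 - 1)"
proof -
  interpret rev: geodesic D "\<lambda>s. g (L - s)" L b0 a0 by (rule reversed)
  obtain F s where F: "F facet_of D" "0 \<le> s" "s < L" "(\<lambda>s. g (L - s)) ` {s..L} \<subseteq> F"
    by (rule rev.final_facet)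
  have sub: "g ` {0..L-s} \<subseteq> F"
  proof safe
    fix y assume "y \<in> {0..L-s}"
    then have "L - y \<in> {s..L}" by auto
    then show "g y \<in> F" using F(4) by (force simp: image_subset_iff)
  qed
  obtain A q0 u0 b where st: "chain q0 u0 0 F A q0 u0 0 b" "norm (u0 * (zeta5 - 1)) = 1"
    by (rule chain_start[OF F(1) _ _ _ sub]) (use F in auto)
  obtain n G B q u a where en: "chain q0 u0 n G B q u a L"
    by (rule chain_reaches_end[OF st(2,1)])
  have A: "unfolds F A" "A ` F = pentagon q0 u0" "A (g 0) = 0" "g 0 \<in> F"
    using st(1) unfolding chain_def by (auto simp: image_subset_iff)
  obtain k where k: "0 = q0 + u0 * zeta5 ^ k"
    using vertex_of_unfolding[OF F(1) A(1,2,4)] A(3) g_0 ends by metis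
  have B: "G facet_of D" "unfolds G B" "B ` G = pentagon q u" "B (g L) = of_real L" "g L \<in> G"
    and n: "real n - 2 \<le> 4 * a" "a < L"
    using en unfolding chain_def by (auto simp: image_subset_iff)
  obtain l where l: "of_real L = q + u * zeta5 ^ l"
    using vertex_of_unfolding[OF B(1-3,5)] B(4) g_L ends by metis
  obtain \<sigma> i x where u: "\<sigma> \<in> {1, -1}" "u = u0 * (\<sigma> * zeta5 ^ i)"
    and q: "x \<in> zeta5_lattice (2 * n)" "q = q0 + u0 * x"
    using en unfolding chain_def by blast
  \<comment> \<open>To the displacement \<open>x\<close> of the centers come two powers: one from
    the starting vertex to the first center, one from the last center to the end vertex.\<close>
  define y where "y = x + (-1) * zeta5 ^ k + \<sigma> * zeta5 ^ (i + l)"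
  have "y \<in> zeta5_lattice (Suc (Suc (2 * n)))"
    unfolding y_def by (intro zeta5_lattice_add_sign_power q u) simp
  then have y: "y \<in> zeta5_lattice (2 * n + 2)" by simp
  have "q0 = - (u0 * zeta5 ^ k)" using k by (simp add: eq_neg_iff_add_eq_0)
  then have "of_real L = u0 * y"
    unfolding l q(2) u(2) y_def by (simp add: power_add algebra_simps)
  then have "L = norm (u0 * y)" using L_pos by (metis abs_of_pos norm_of_real)
  moreover have "norm u0 = 1 / norm (zeta5 - 1)"
    using st(2) zeta5_neq_1 by (simp add: norm_mult divide_simps)
  ultimately have "L = norm y / norm (zeta5 - 1)" by (simp add: norm_mult)
  then show ?thesis using that[OF y] n by simp
qed

end

section \<open>Counting sums\<close>

text \<open>The cap \<open>K\<close> on the multiplicities keeps the set finite; up to a given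
  \<open>t\<close>, sums of lengths bounded below never exceed a suitable cap.\<close>

definition bounded_sums :: "nat \<Rightarrow> real set \<Rightarrow> real set" where
  "bounded_sums K A = {\<Sum>\<kappa>\<in>A. real (n \<kappa>) * \<kappa> | n. \<forall>\<kappa>\<in>A. n \<kappa> \<le> K}"

lemma bounded_sums_insert:
  assumes "finite A" "l \<notin> A"
  shows "bounded_sums K (insert l A) \<subseteq> (\<lambda>(k, \<sigma>). real k * l + \<sigma>) ` ({..K} \<times> bounded_sums K A)"
proof
  fix x assume "x \<in> bounded_sums K (insert l A)"
  then obtain n where n: "x = (\<Sum>\<kappa>\<in>insert l A. real (n \<kappa>) * \<kappa>)" "\<forall>\<kappa>\<in>insert l A. n \<kappa> \<le> K"
    by (auto simp: bounded_sums_def)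
  then have "x = real (n l) * l + (\<Sum>\<kappa>\<in>A. real (n \<kappa>) * \<kappa>)"
    using assms by simp
  moreover have "(\<Sum>\<kappa>\<in>A. real (n \<kappa>) * \<kappa>) \<in> bounded_sums K A"
    using n by (auto simp: bounded_sums_def)
  ultimately show "x \<in> (\<lambda>(k, \<sigma>). real k * l + \<sigma>) ` ({..K} \<times> bounded_sums K A)"
    using n by force
qed

lemma finite_bounded_sums: "finite A \<Longrightarrow> finite (bounded_sums K A)"
proof (induction A rule: finite_induct)
  case empty
  have "bounded_sums K {} = {0}" by (auto simp: bounded_sums_def)
  then show ?case by simp
next
  case (insert l A)
  show ?case
    by (rule finite_subset[OF bounded_sums_insert]) (use insert in auto)
qed

text \<open>Euler's product for partitions with parts in \<open>A\<close>. It is only an inequality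
  because the multiplicities are capped and coinciding sums are counted once.\<close>

lemma bounded_sums_partition_function:
  assumes "finite A" "x > 0" "\<And>\<kappa>. \<kappa> \<in> A \<Longrightarrow> \<kappa> > 0"
  shows "(\<Sum>\<sigma>\<in>bounded_sums K A. exp (- x * \<sigma>)) \<le> (\<Prod>\<kappa>\<in>A. 1 / (1 - exp (- x * \<kappa>)))"
  using assms
proof (induction A rule: finite_induct)
  case empty
  have "bounded_sums K {} = {0}" by (auto simp: bounded_sums_def)
  then show ?case by simp
next
  case (insert l A)
  define q where "q = exp (- x * l)"
  have q: "0 < q" "q < 1" using insert.prems by (auto simp: q_def)
  have geo: "(\<Sum>k\<le>K. q ^ k) \<le> 1 / (1 - q)"
  proof -
    have "(\<Sum>k\<le>K. q ^ k) * (1 - q) \<le> 1"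
      using sum_gp_basic[of q K] q by (simp add: mult.commute)
    then show ?thesis using q by (simp add: pos_le_divide_eq)
  qed
  have "(\<Sum>\<sigma>\<in>bounded_sums K (insert l A). exp (- x * \<sigma>))
      \<le> (\<Sum>\<sigma>\<in>(\<lambda>(k, \<sigma>). real k * l + \<sigma>) ` ({..K} \<times> bounded_sums K A). exp (- x * \<sigma>))"
    by (intro sum_mono2 bounded_sums_insert) (use insert finite_bounded_sums in auto)
  also have "\<dots> \<le> (\<Sum>p\<in>{..K} \<times> bounded_sums K A. exp (- x * ((\<lambda>(k, \<sigma>). real k * l + \<sigma>) p)))"
    by (rule order_trans[OF sum_image_le]) (use insert finite_bounded_sums in \<open>auto simp: o_def\<close>)
  also have "\<dots> = (\<Sum>k\<le>K. \<Sum>\<sigma>\<in>bounded_sums K A. q ^ k * exp (- x * \<sigma>))"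
    by (subst sum.cartesian_product)
       (auto intro!: sum.cong simp: q_def exp_of_nat_mult[symmetric] exp_add[symmetric] algebra_simps)
  also have "\<dots> = (\<Sum>k\<le>K. q ^ k) * (\<Sum>\<sigma>\<in>bounded_sums K A. exp (- x * \<sigma>))"
    by (simp add: sum_product)
  also have "\<dots> \<le> 1 / (1 - q) * (\<Prod>\<kappa>\<in>A. 1 / (1 - exp (- x * \<kappa>)))"
    by (intro mult_mono geo insert.IH) (use insert q in \<open>auto intro!: sum_nonneg\<close>)
  finally show ?case using insert by (simp add: q_def)
qed

lemma inverse_one_minus_exp_le:
  assumes "(y::real) > 0"
  shows "1 / (1 - exp (- y)) \<le> exp (1 / (exp y - 1))"
proof -
  have "1 / (1 - exp (- y)) = 1 + 1 / (exp y - 1)"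
    using assms by (simp add: exp_minus field_simps)
  also have "\<dots> \<le> exp (1 / (exp y - 1))" by (rule exp_ge_add_one_self)
  finally show ?thesis .
qed

text \<open>The first bound serves small \<open>y\<close>, the second large \<open>y\<close>; the
  sixth power is chosen to outweigh a count that grows like a fifth power.\<close>

lemma inverse_exp_minus_one_le:
  assumes "(y::real) > 0"
  shows "1 / (exp y - 1) \<le> 1 / y" "1 / (exp y - 1) \<le> 6 ^ 6 / y ^ 6"
proof -
  have "y \<le> exp y - 1" using exp_ge_add_one_self[of y] by linarith
  then show "1 / (exp y - 1) \<le> 1 / y" using assms by (simp add: frac_le)
  have "1 + z ^ 6 \<le> (1 + z) ^ 6" if "z \<ge> 0" for z :: real
  proof -
    have "(1 + z) ^ 6 = 1 + z ^ 6 + (6 * z + 15 * z ^ 2 + 20 * z ^ 3 + 15 * z ^ 4 + 6 * z ^ 5)"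
      by (simp add: eval_nat_numeral algebra_simps)
    then show ?thesis using that by simp
  qed
  then have "1 + (y / 6) ^ 6 \<le> (1 + y / 6) ^ 6"
    using assms by simp
  also have "\<dots> \<le> exp (y / 6) ^ 6"
    by (intro power_mono exp_ge_add_one_self) (use assms in simp)
  also have "\<dots> = exp y" by (simp flip: exp_of_nat_mult)
  finally have "(y / 6) ^ 6 \<le> exp y - 1" by simp
  then have "1 / (exp y - 1) \<le> 1 / ((y / 6) ^ 6)" using assms by (intro frac_le) auto
  then show "1 / (exp y - 1) \<le> 6 ^ 6 / y ^ 6" by (simp add: power_divide)
qed

section \<open>Dyadic estimate of the partition function\<close>

lemma ex_dyadic_shell:
  assumes "(z::real) \<ge> 1"
  shows "\<exists>m. 2 ^ m \<le> z \<and> z < 2 ^ Suc m"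
proof -
  obtain n where "z < 2 ^ n" using real_arch_pow[of 2 z] by auto
  then have *: "\<exists>n. z < 2 ^ Suc n" by (metis (no_types) assms le_less_trans not_less_iff_gr_or_eq old.nat.exhaust power_0)
  define m where "m = (LEAST n. z < 2 ^ Suc n)"
  have "z < 2 ^ Suc m" unfolding m_def by (rule LeastI_ex[OF *])
  moreover have "2 ^ m \<le> z"
  proof (cases m)
    case 0 then show ?thesis using assms by simp
  next
    case (Suc k)
    then have "\<not> z < 2 ^ Suc k" using not_less_Least[of k "\<lambda>n. z < 2 ^ Suc n"] by (simp add: m_def)
    then show ?thesis using Suc by simp
  qed
  ultimately show ?thesis by blast
qed

lemma sum_half_powers_le: "finite T \<Longrightarrow> (\<Sum>m\<in>T. (1/2::real) ^ m) \<le> 2"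
  using sum_le_suminf[of "\<lambda>m. (1/2::real)^m" T] suminf_geometric[of "1/2::real"]
  by (simp add: summable_geometric)

lemma sum_by_shells:
  fixes f :: "'a \<Rightarrow> real"
  assumes "finite A"
    and le: "\<And>a. a \<in> A \<Longrightarrow> f a \<le> b (\<mu> a)"
    and card: "\<And>m. real (card {a\<in>A. \<mu> a = m}) * b m \<le> G * (1/2) ^ m"
    and "G \<ge> 0"
  shows "sum f A \<le> 2 * G"
proof -
  have "sum f A = (\<Sum>m\<in>\<mu> ` A. \<Sum>a\<in>{a\<in>A. \<mu> a = m}. f a)"
    using assms(1) by (intro sum.group[symmetric]) auto
  also have "\<dots> \<le> (\<Sum>m\<in>\<mu> ` A. G * (1/2) ^ m)"
  proof (rule sum_mono)
    fix m
    have "(\<Sum>a\<in>{a\<in>A. \<mu> a = m}. f a) \<le> of_nat (card {a\<in>A. \<mu> a = m}) * b m"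
      by (rule sum_bounded_above) (use le in auto)
    then show "(\<Sum>a\<in>{a\<in>A. \<mu> a = m}. f a) \<le> G * (1/2) ^ m" using card[of m] by simp
  qed
  also have "\<dots> = G * (\<Sum>m\<in>\<mu> ` A. (1/2) ^ m)" by (simp add: sum_distrib_left)
  also have "\<dots> \<le> G * 2" by (intro mult_left_mono sum_half_powers_le) (use assms in auto)
  finally show ?thesis by simp
qed

text \<open>The sum is split at \<open>B\<close>. Below \<open>B\<close>, the shell at scale
  \<open>B / 2 ^ m\<close> contributes at most \<open>2 * C * B ^ 5 * (1/16) ^ m\<close>; above, the
  shell at scale \<open>2 ^ m * B\<close> contributes at most
  \<open>32 * 6 ^ 6 * C * B ^ 5 * (1/2) ^ m\<close>. Each series costs a factor 2, which gives the
  constant.\<close>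

lemma partition_function_exponent_le:
  fixes A :: "real set"
  assumes "finite A" and pos: "\<And>\<kappa>. \<kappa> \<in> A \<Longrightarrow> \<kappa> > 0" and "C \<ge> 0"
    and card: "\<And>s. s > 0 \<Longrightarrow> real (card {\<kappa>\<in>A. \<kappa> \<le> s}) \<le> C * s ^ 5"
    and "B > 0"
  shows "(\<Sum>\<kappa>\<in>A. 1 / (exp (\<kappa> / B) - 1)) \<le> (4 + 64 * 6 ^ 6) * C * B ^ 5"
proof -
  define A1 where "A1 = {\<kappa>\<in>A. \<kappa> \<le> B}"
  define A2 where "A2 = {\<kappa>\<in>A. \<kappa> > B}"
  have fin: "finite A1" "finite A2" using assms by (auto simp: A1_def A2_def)
  have "\<exists>m. 2 ^ m \<le> B / \<kappa> \<and> B / \<kappa> < 2 ^ Suc m" if "\<kappa> \<in> A1" for \<kappa>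
    using that pos by (intro ex_dyadic_shell) (auto simp: A1_def)
  then obtain \<mu> where \<mu>: "\<And>\<kappa>. \<kappa> \<in> A1 \<Longrightarrow> 2 ^ \<mu> \<kappa> \<le> B / \<kappa> \<and> B / \<kappa> < 2 ^ Suc (\<mu> \<kappa>)" by metis
  have "\<exists>m. 2 ^ m \<le> \<kappa> / B \<and> \<kappa> / B < 2 ^ Suc m" if "\<kappa> \<in> A2" for \<kappa>
    using that pos \<open>B > 0\<close> by (intro ex_dyadic_shell) (auto simp: A2_def)
  then obtain \<nu> where \<nu>: "\<And>\<kappa>. \<kappa> \<in> A2 \<Longrightarrow> 2 ^ \<nu> \<kappa> \<le> \<kappa> / B \<and> \<kappa> / B < 2 ^ Suc (\<nu> \<kappa>)" by metis
  have S1: "(\<Sum>\<kappa>\<in>A1. 1 / (exp (\<kappa> / B) - 1)) \<le> 2 * (2 * C * B ^ 5)"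
  proof (rule sum_by_shells[where \<mu> = \<mu> and b = "\<lambda>m. 2 * 2 ^ m"])
    fix \<kappa> assume l: "\<kappa> \<in> A1"
    then have "\<kappa> > 0" using pos by (auto simp: A1_def)
    then have "1 / (exp (\<kappa> / B) - 1) \<le> B / \<kappa>" using inverse_exp_minus_one_le(1)[of "\<kappa>/B"] \<open>B > 0\<close> by simp
    then show "1 / (exp (\<kappa> / B) - 1) \<le> 2 * 2 ^ \<mu> \<kappa>" using \<mu>[OF l] by simp
  next
    fix m
    have "{a \<in> A1. \<mu> a = m} \<subseteq> {\<kappa>\<in>A. \<kappa> \<le> B / 2 ^ m}"
    proof safe
      fix l assume l: "l \<in> A1" "m = \<mu> l"
      then show "l \<in> A" by (simp add: A1_def)
      then show "l \<le> B / 2 ^ \<mu> l" using \<mu>[OF l(1)] pos[of l] by (simp add: field_simps)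
    qed
    then have "card {a \<in> A1. \<mu> a = m} \<le> card {\<kappa>\<in>A. \<kappa> \<le> B / 2 ^ m}"
      by (intro card_mono) (use assms in auto)
    also have "real \<dots> \<le> C * (B / 2 ^ m) ^ 5" by (rule card) (use assms in auto)
    finally have "real (card {a \<in> A1. \<mu> a = m}) * (2 * 2 ^ m) \<le> C * (B / 2 ^ m) ^ 5 * (2 * 2 ^ m)" by simp
    also have "\<dots> = 2 * C * B ^ 5 * (1 / 16) ^ m"
    proof -
      have "((2::real) ^ m) ^ 5 = 16 ^ m * 2 ^ m"
        by (simp flip: power_mult_distrib power_mult) (simp add: power_mult mult.commute[of m])
      then show ?thesis by (simp add: power_divide field_simps)
    qed
    also have "\<dots> \<le> 2 * C * B ^ 5 * (1 / 2) ^ m"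
      by (intro mult_left_mono power_mono) (use assms in auto)
    finally show "real (card {a \<in> A1. \<mu> a = m}) * (2 * 2 ^ m) \<le> 2 * C * B ^ 5 * (1 / 2) ^ m" .
  qed (use fin assms in auto)
  have S2: "(\<Sum>\<kappa>\<in>A2. 1 / (exp (\<kappa> / B) - 1)) \<le> 2 * (32 * 6 ^ 6 * C * B ^ 5)"
  proof (rule sum_by_shells[where \<mu> = \<nu> and b = "\<lambda>m. 6 ^ 6 / (2 ^ m) ^ 6"])
    fix \<kappa> assume l: "\<kappa> \<in> A2"
    then have "\<kappa> > 0" using pos by (auto simp: A2_def)
    then have "1 / (exp (\<kappa> / B) - 1) \<le> 6 ^ 6 / (\<kappa> / B) ^ 6"
      using inverse_exp_minus_one_le(2)[of "\<kappa>/B"] \<open>B > 0\<close> by simp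
    also have "\<dots> \<le> 6 ^ 6 / (2 ^ \<nu> \<kappa>) ^ 6"
      by (intro divide_left_mono power_mono) (use \<nu>[OF l] \<open>\<kappa> > 0\<close> \<open>B > 0\<close> in auto)
    finally show "1 / (exp (\<kappa> / B) - 1) \<le> 6 ^ 6 / (2 ^ \<nu> \<kappa>) ^ 6" .
  next
    fix m
    have "{a \<in> A2. \<nu> a = m} \<subseteq> {\<kappa>\<in>A. \<kappa> \<le> 2 * 2 ^ m * B}"
    proof safe
      fix l assume l: "l \<in> A2" "m = \<nu> l"
      then show "l \<in> A" by (simp add: A2_def)
      then show "l \<le> 2 * 2 ^ \<nu> l * B" using \<nu>[OF l(1)] \<open>B > 0\<close> by (simp add: field_simps)
    qed
    then have "card {a \<in> A2. \<nu> a = m} \<le> card {\<kappa>\<in>A. \<kappa> \<le> 2 * 2 ^ m * B}"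
      by (intro card_mono) (use assms in auto)
    also have "real \<dots> \<le> C * (2 * 2 ^ m * B) ^ 5" by (rule card) (use assms in auto)
    finally have "real (card {a \<in> A2. \<nu> a = m}) * (6 ^ 6 / (2 ^ m) ^ 6)
        \<le> C * (2 * 2 ^ m * B) ^ 5 * (6 ^ 6 / (2 ^ m) ^ 6)"
      by (intro mult_right_mono) auto
    also have "\<dots> = 32 * 6 ^ 6 * C * B ^ 5 * (1 / 2) ^ m"
      by (simp add: power_mult_distrib power_divide divide_simps power_numeral_reduce)
    finally show "real (card {a \<in> A2. \<nu> a = m}) * (6 ^ 6 / (2 ^ m) ^ 6)
        \<le> 32 * 6 ^ 6 * C * B ^ 5 * (1 / 2) ^ m" .
  qed (use fin assms in auto)
  have "A = A1 \<union> A2" "A1 \<inter> A2 = {}" by (auto simp: A1_def A2_def)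
  then have "(\<Sum>\<kappa>\<in>A. 1 / (exp (\<kappa> / B) - 1))
      = (\<Sum>\<kappa>\<in>A1. 1 / (exp (\<kappa> / B) - 1)) + (\<Sum>\<kappa>\<in>A2. 1 / (exp (\<kappa> / B) - 1))"
    using fin by (simp add: sum.union_disjoint)
  also have "\<dots> \<le> (4 + 64 * 6 ^ 6) * C * B ^ 5" using S1 S2 by (simp add: algebra_simps)
  finally show ?thesis .
qed

lemma sum_list_mem_bounded_sums:
  assumes "finite A" "set ls \<subseteq> A" "length ls \<le> K"
  shows "sum_list ls \<in> bounded_sums K A"
proof -
  have "sum_list ls = (\<Sum>\<kappa>\<in>A. real (count_list ls \<kappa>) * \<kappa>)"
    using assms(2)
  proof (induction ls)
    case (Cons l ls)
    have "(\<Sum>\<kappa>\<in>A. real (count_list (l # ls) \<kappa>) * \<kappa>)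
        = (\<Sum>\<kappa>\<in>A. real (count_list ls \<kappa>) * \<kappa> + (if \<kappa> = l then l else 0))"
      by (rule sum.cong) (auto simp: algebra_simps)
    then show ?case using Cons assms(1) by (simp add: sum.distrib)
  qed simp
  then show ?thesis
    using assms(3) unfolding bounded_sums_def
    by (auto intro!: exI[of _ "count_list ls"] intro: order_trans[OF count_le_length])
qed

text \<open>Each sum up to \<open>t\<close> has weight at least \<open>exp (- t / B)\<close> in the
  partition function at \<open>x = 1 / B\<close>, which bounds the number of such sums.\<close>

lemma card_finite_sums_less:
  fixes \<Lambda> :: "real set"
  assumes "\<delta> > 0" and ge: "\<And>\<kappa>. \<kappa> \<in> \<Lambda> \<Longrightarrow> \<delta> \<le> \<kappa>" and "C \<ge> 0"
    and fin: "\<And>s. finite {\<kappa>\<in>\<Lambda>. \<kappa> \<le> s}"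
    and card: "\<And>s. s > 0 \<Longrightarrow> real (card {\<kappa>\<in>\<Lambda>. \<kappa> \<le> s}) \<le> C * s ^ 5"
  shows "\<exists>c>0. \<forall>t>0. finite {sum_list ls |ls. set ls \<subseteq> \<Lambda> \<and> sum_list ls \<le> t} \<and>
            real (card {sum_list ls |ls. set ls \<subseteq> \<Lambda> \<and> sum_list ls \<le> t}) < exp (c * t powr (5/6))"
proof -
  define G where "G = (4 + 64 * 6 ^ 6) * C"
  have "G \<ge> 0" using assms by (simp add: G_def)
  have "finite {sum_list ls |ls. set ls \<subseteq> \<Lambda> \<and> sum_list ls \<le> t} \<and>
        real (card {sum_list ls |ls. set ls \<subseteq> \<Lambda> \<and> sum_list ls \<le> t}) < exp ((2 + G) * t powr (5/6))"
    (is "finite ?X \<and> _")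
    if "t > 0" for t
  proof -
    define A where "A = {\<kappa>\<in>\<Lambda>. \<kappa> \<le> t}"
    \<comment> \<open>A sum up to \<open>t\<close> has at most \<open>t / \<delta>\<close> terms, so
      no multiplicity exceeds \<open>K\<close>.\<close>
    define K where "K = nat \<lceil>t / \<delta>\<rceil>"
    have A: "finite A" "\<And>\<kappa>. \<kappa> \<in> A \<Longrightarrow> \<kappa> > 0"
      using fin ge \<open>\<delta> > 0\<close> by (auto simp: A_def intro: less_le_trans)
    have len: "\<delta> * length ls \<le> sum_list ls" if "set ls \<subseteq> \<Lambda>" for ls
      using that by (induction ls) (auto simp: algebra_simps dest!: ge)
    have mem: "\<kappa> \<le> sum_list ls" if "set ls \<subseteq> \<Lambda>" "\<kappa> \<in> set ls" for \<kappa> ls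
      using that ge \<open>\<delta> > 0\<close> by (intro member_le_sum_list) (force intro: less_le_trans less_imp_le)+
    have sub: "?X \<subseteq> {\<sigma>\<in>bounded_sums K A. \<sigma> \<le> t}"
    proof safe
      fix ls assume ls: "set ls \<subseteq> \<Lambda>" "sum_list ls \<le> t"
      have "real (length ls) \<le> t / \<delta>" using len[OF ls(1)] ls(2) \<open>\<delta> > 0\<close> by (simp add: field_simps)
      then have "length ls \<le> K" by (simp add: K_def) linarith
      then show "sum_list ls \<in> bounded_sums K A"
        using mem ls by (intro sum_list_mem_bounded_sums A) (force simp: A_def)+
    qed
    have finX: "finite ?X" by (rule finite_subset[OF sub]) (use finite_bounded_sums A in auto)
    define B where "B = t powr (1/6)"
    have B: "B > 0" using that by (simp add: B_def)
    have B5: "B ^ 5 = t powr (5/6)" "t / B = t powr (5/6)"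
      using that powr_diff[of t 1 "1/6"] by (simp_all add: B_def powr_realpow[symmetric] powr_powr)
    have "real (card ?X) * exp (- (t / B)) = (\<Sum>\<sigma>\<in>?X. exp (- (t / B)))" by simp
    also have "\<dots> \<le> (\<Sum>\<sigma>\<in>?X. exp (- (1 / B) * \<sigma>))"
      by (rule sum_mono) (use B in \<open>auto intro: divide_right_mono\<close>)
    also have "\<dots> \<le> (\<Sum>\<sigma>\<in>bounded_sums K A. exp (- (1 / B) * \<sigma>))"
      by (rule sum_mono2) (use sub finite_bounded_sums A in auto)
    also have "\<dots> \<le> (\<Prod>\<kappa>\<in>A. 1 / (1 - exp (- (1 / B) * \<kappa>)))"
      by (rule bounded_sums_partition_function) (use A B in auto)
    also have "\<dots> \<le> (\<Prod>\<kappa>\<in>A. exp (1 / (exp (\<kappa> / B) - 1)))"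
    proof (rule prod_mono)
      fix \<kappa> assume "\<kappa> \<in> A"
      then have "\<kappa> / B > 0" using A B by simp
      then show "0 \<le> 1 / (1 - exp (- (1 / B) * \<kappa>)) \<and>
          1 / (1 - exp (- (1 / B) * \<kappa>)) \<le> exp (1 / (exp (\<kappa> / B) - 1))"
        using inverse_one_minus_exp_le[of "\<kappa> / B"] by simp
    qed
    also have "\<dots> = exp (\<Sum>\<kappa>\<in>A. 1 / (exp (\<kappa> / B) - 1))" using A by (simp add: exp_sum)
    also have "\<dots> \<le> exp (G * B ^ 5)"
    proof -
      have "real (card {\<kappa>\<in>A. \<kappa> \<le> s}) \<le> C * s ^ 5" if "s > 0" for s
      proof -
        have "card {\<kappa>\<in>A. \<kappa> \<le> s} \<le> card {\<kappa>\<in>\<Lambda>. \<kappa> \<le> s}"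
          by (rule card_mono) (use fin in \<open>auto simp: A_def\<close>)
        then show ?thesis using card[OF that] by linarith
      qed
      then show ?thesis unfolding G_def
        using partition_function_exponent_le[OF A(1) A(2) \<open>C \<ge> 0\<close> _ B] by simp
    qed
    finally have "real (card ?X) * exp (- (t / B)) \<le> exp (G * B ^ 5)" .
    then have "real (card ?X) \<le> exp (G * B ^ 5) * exp (t / B)"
      by (simp add: exp_minus field_simps)
    also have "\<dots> = exp ((1 + G) * t powr (5/6))"
      by (simp add: B5 exp_add[symmetric] algebra_simps)
    \<comment> \<open>Raising the constant from \<open>1 + G\<close> to \<open>2 + G\<close> serves
      only to make the inequality strict.\<close>
    also have "\<dots> < exp ((2 + G) * t powr (5/6))" using that by (simp add: algebra_simps)
    finally show ?thesis using finX by blast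
  qed
  then show ?thesis using \<open>G \<ge> 0\<close> by (intro exI[of _ "2 + G"]) auto
qed

section \<open>From segment lengths to arrival times\<close>

context pentagonal_polytope
begin

definition geodesic_lengths :: "real set" where
  "geodesic_lengths = {L. \<exists>g a b. geodesic_segment D g L a b}"

lemma geodesic_lengths_pos: "L \<in> geodesic_lengths \<Longrightarrow> L > 0"
  by (auto simp: geodesic_lengths_def geodesic_segment_def)

lemma finite_geodesic_lengths: "finite {L \<in> geodesic_lengths. L \<le> s}"
  and card_geodesic_lengths: "s > 0 \<Longrightarrow> real (card {L \<in> geodesic_lengths. L \<le> s}) \<le> (16 * s + 15) ^ 5"
proof -
  \<comment> \<open>With \<open>real n \<le> 4 * L + 2\<close> the coefficient bound
    \<open>2 * n + 2\<close> is at most \<open>8 * s + 6\<close>.\<close>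
  define N where "N = nat \<lfloor>8 * s + 6\<rfloor>"
  let ?f = "\<lambda>x. norm x / norm (zeta5 - 1)"
  have sub: "{L \<in> geodesic_lengths. L \<le> s} \<subseteq> ?f ` zeta5_lattice N"
  proof safe
    fix L assume "L \<in> geodesic_lengths" "L \<le> s"
    then obtain g a b where "geodesic_segment D g L a b" by (auto simp: geodesic_lengths_def)
    then interpret geodesic D g L a b by unfold_locales
    obtain n x where n: "x \<in> zeta5_lattice (2 * n + 2)" "real n \<le> 4 * L + 2" "L = ?f x"
      by (rule length_in_lattice)
    have "real (2 * n + 2) \<le> 8 * s + 6" using n(2) \<open>L \<le> s\<close> by simp
    then have "2 * n + 2 \<le> N" unfolding N_def by linarith
    then show "L \<in> ?f ` zeta5_lattice N" using n zeta5_lattice_mono by blast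
  qed
  show "finite {L \<in> geodesic_lengths. L \<le> s}"
    by (rule finite_subset[OF sub]) (simp add: finite_zeta5_lattice)
  assume "s > 0"
  have "card {L \<in> geodesic_lengths. L \<le> s} \<le> card (zeta5_lattice N)"
    by (rule surj_card_le[OF finite_zeta5_lattice sub])
  also have "\<dots> \<le> (2 * N + 1) ^ 5" by (rule card_zeta5_lattice_le)
  finally have "real (card {L \<in> geodesic_lengths. L \<le> s}) \<le> real ((2 * N + 1) ^ 5)"
    by (rule of_nat_mono)
  also have "\<dots> = (2 * real N + 1) ^ 5" by (simp add: add.commute)
  also have "\<dots> \<le> (16 * s + 15) ^ 5"
  proof (rule power_mono)
    have "real N \<le> 8 * s + 6" unfolding N_def using \<open>s > 0\<close> by simp
    then show "2 * real N + 1 \<le> 16 * s + 15" by simp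
  qed simp
  finally show "real (card {L \<in> geodesic_lengths. L \<le> s}) \<le> (16 * s + 15) ^ 5" .
qed

text \<open>Only finitely many lengths are at most 1 and all are positive, so a least one exists;
  the inserted 1 covers the case of no such length and all longer segments.\<close>

lemma geodesic_lengths_bounded_below:
  obtains \<delta> where "\<delta> > 0" "\<And>L. L \<in> geodesic_lengths \<Longrightarrow> \<delta> \<le> L"
proof -
  define M where "M = insert 1 {L \<in> geodesic_lengths. L \<le> 1}"
  have M: "finite M" "M \<noteq> {}" by (auto simp: M_def finite_geodesic_lengths)
  show ?thesis
  proof (rule that[of "Min M"])
    show "Min M > 0" using M geodesic_lengths_pos by (auto simp: M_def)
    fix L assume L: "L \<in> geodesic_lengths"
    show "Min M \<le> L"
    proof (cases "L \<le> 1")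
      case True then show ?thesis using M L by (intro Min_le) (auto simp: M_def)
    next
      case False
      have "Min M \<le> 1" using M by (intro Min_le) (auto simp: M_def)
      then show ?thesis using False by simp
    qed
  qed
qed

lemma broken_geodesic_length:
  assumes "broken_geodesic D S b l"
  shows "\<exists>ls. set ls \<subseteq> geodesic_lengths \<and> sum_list ls = l"
  using assms
proof induction
  case (single g L b)
  then show ?case by (intro exI[of _ "[L]"]) (auto simp: geodesic_lengths_def)
next
  case (append b l g L c)
  then obtain ls where "set ls \<subseteq> geodesic_lengths" "sum_list ls = l" by blast
  then show ?case using append by (intro exI[of _ "L # ls"]) (auto simp: geodesic_lengths_def)
qed

lemma arrival_times_bound:
  "\<exists>c>0. \<forall>t>0. finite (arrival_times D S t) \<and> real (num_waves D S t) < exp (c * t powr (5/6))"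
proof -
  obtain \<delta> where \<delta>: "\<delta> > 0" "\<And>L. L \<in> geodesic_lengths \<Longrightarrow> \<delta> \<le> L"
    using geodesic_lengths_bounded_below by metis
  \<comment> \<open>For \<open>s \<ge> \<delta>\<close> the constant 15 is at most
    \<open>15 / \<delta> * s\<close>, so the affine bound becomes homogeneous; for smaller
    \<open>s\<close> there is no length to count.\<close>
  define C where "C = (16 + 15 / \<delta>) ^ 5"
  have "C \<ge> 0" using \<delta> by (simp add: C_def)
  have card: "real (card {L \<in> geodesic_lengths. L \<le> s}) \<le> C * s ^ 5" if "s > 0" for s
  proof (cases "s < \<delta>")
    case True
    then have "{L \<in> geodesic_lengths. L \<le> s} = {}" using \<delta>(2) by force
    then have "card {L \<in> geodesic_lengths. L \<le> s} = 0" by (simp only: card.empty)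
    then show ?thesis using \<open>C \<ge> 0\<close> that by simp
  next
    case False
    have "real (card {L \<in> geodesic_lengths. L \<le> s}) \<le> (16 * s + 15) ^ 5"
      by (rule card_geodesic_lengths[OF that])
    also have "\<dots> \<le> ((16 + 15 / \<delta>) * s) ^ 5"
      by (rule power_mono) (use False \<delta> that in \<open>auto simp: field_simps\<close>)
    finally show ?thesis by (simp add: C_def power_mult_distrib)
  qed
  let ?X = "\<lambda>t. {sum_list ls |ls. set ls \<subseteq> geodesic_lengths \<and> sum_list ls \<le> t}"
  obtain c where c: "c > 0" "\<And>t. t > 0 \<Longrightarrow> finite (?X t) \<and> real (card (?X t)) < exp (c * t powr (5/6))"
    using card_finite_sums_less[OF \<delta> \<open>C \<ge> 0\<close> finite_geodesic_lengths card] by blast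
  have sub: "arrival_times D S t \<subseteq> ?X t" for t
    using broken_geodesic_length by (fastforce simp: arrival_times_def)
  show ?thesis
  proof (intro exI[of _ c] conjI allI impI c(1))
    fix t :: real assume "t > 0"
    note ct = c(2)[OF this]
    show "finite (arrival_times D S t)" using finite_subset[OF sub] ct by blast
    have "num_waves D S t \<le> card (?X t)" unfolding num_waves_def using card_mono[OF _ sub] ct by blast
    then show "real (num_waves D S t) < exp (c * t powr (5/6))" using ct by linarith
  qed
qed

end

theorem mainTheorem4:
  fixes D :: "(real^3) set" and S :: "real^3"
  assumes "regular_dodecahedron 1 D"
    and "S \<in> vertices D"
  shows "\<exists>c>0. \<forall>t>0. finite (arrival_times D S t) \<and>
           real (num_waves D S t) < exp (c * t powr (5/6))"
proof -
  interpret pentagonal_polytope D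
    by unfold_locales (use assms in \<open>auto simp: regular_dodecahedron_def\<close>)
  show ?thesis by (rule arrival_times_bound)
qed

end
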